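(* Equality of stochastic global functions of one-dimensional stochastic cellular automata is decidable: there is an algorithm which, given two one-dimensional stochastic cellular automata with explicit global functions $F$ and $G$, decides whether $\mathcal{S}_F=\mathcal{S}_G$.
   Context: A (one-dimensional) stochastic cellular automaton is a tuple $(Q,R,V,V',f)$ where $Q$ (states) and $R$ (random symbols) are finite sets, $V=\{v_1,\dots,v_\rho\}$ and $V'=\{v'_1,\dots,v'_{\rho'}\}$ are finite subsets of $\mathbb{Z}$, and $f:Q^\rho\times R^{\rho'}\to Q$. Its explicit global function is $F:Q^{\mathbb{Z}}\times R^{\mathbb{Z}}\to Q^{\mathbb{Z}}$, $F(c,s)_z=f\big((c_{z+v_j})_j,(s_{z+v'_j})_j\big)$. Its stochastic global function maps $c\in Q^{\mathbb{Z}}$ to the Borel probability measure $\mathcal{S}_F(c)$ on $Q^{\mathbb{Z}}$ that is the law of $F(c,s)$ when $s$ is drawn from the uniform (i.i.d. uniform product) measure on $R^{\mathbb{Z}}$. The two automata may have different sets of random symbols and neighborhoods. CA are given as inputs by their finite description $(Q,R,V,V',f)$. *)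

theory Defs
  imports "HOL-Probability.Probability" "HOL-Library.Nat_Bijection"
begin

section \<open>Stochastic cellular automata\<close>

text \<open>
  States and random symbols are named by natural numbers, so that an automaton is a finite
  description. The neighborhoods are given by their enumerations \<open>v\<^sub>1, \<dots>, v\<^sub>\<rho>\<close>, which fix the order
  of the arguments of the local rule; the values of \<open>rule\<close> outside
  \<open>Q\<^sup>\<rho> \<times> R\<^sup>\<rho>\<^sup>'\<close> play no role.
\<close>

record sca =
  states :: "nat set"
  symbols :: "nat set"
  nbh :: "int list"
  symbol_nbh :: "int list"
  rule :: "nat list \<Rightarrow> nat list \<Rightarrow> nat"

text \<open>
  The set of random symbols has to be nonempty for the uniform measure to exist.
\<close>

definition stochastic_CA :: "sca \<Rightarrow> bool" where
  "stochastic_CA A \<longleftrightarrow>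
     finite (states A) \<and> finite (symbols A) \<and> symbols A \<noteq> {} \<and>
     distinct (nbh A) \<and> distinct (symbol_nbh A) \<and>
     (\<forall>qs rs. set qs \<subseteq> states A \<and> length qs = length (nbh A) \<and>
              set rs \<subseteq> symbols A \<and> length rs = length (symbol_nbh A)
              \<longrightarrow> rule A qs rs \<in> states A)"

definition explicit_global :: "sca \<Rightarrow> (int \<Rightarrow> nat) \<Rightarrow> (int \<Rightarrow> nat) \<Rightarrow> (int \<Rightarrow> nat)" where
  "explicit_global A c s =
     (\<lambda>z. rule A (map (\<lambda>v. c (z + v)) (nbh A)) (map (\<lambda>v. s (z + v)) (symbol_nbh A)))"

text \<open>
  The product sigma-algebra on \<open>Q\<^sup>\<int>\<close> is the Borel sigma-algebra of the product topology, as \<open>Q\<close> is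
  finite and discrete and the index set is countable.
\<close>

definition config_space :: "sca \<Rightarrow> (int \<Rightarrow> nat) measure" where
  "config_space A = (\<Pi>\<^sub>M z\<in>UNIV. count_space (states A))"

definition symbol_measure :: "sca \<Rightarrow> (int \<Rightarrow> nat) measure" where
  "symbol_measure A = (\<Pi>\<^sub>M z\<in>UNIV. uniform_count_measure (symbols A))"

text \<open>
  A partial map with domain exactly \<open>Q\<^sup>\<int>\<close>, so that HOL equality of two stochastic global functions
  is equality of their domains and of their values there. In particular, automata with different
  sets of states have different stochastic global functions.
\<close>

definition stochastic_global :: "sca \<Rightarrow> (int \<Rightarrow> nat) \<rightharpoonup> (int \<Rightarrow> nat) measure" where
  "stochastic_global A = (\<lambda>c.
     if c \<in> UNIV \<rightarrow> states A
     then Some (distr (symbol_measure A) (config_space A) (explicit_global A c))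
     else None)"

lemma measurable_explicit_global:
  assumes A: "stochastic_CA A" and c: "c \<in> UNIV \<rightarrow> states A"
  shows "explicit_global A c \<in> measurable (symbol_measure A) (config_space A)"
proof -
  let ?M = "symbol_measure A" and ?V = "symbol_nbh A"
  have spM: "space ?M = UNIV \<rightarrow> symbols A"
    by (simp add: symbol_measure_def space_PiM space_uniform_count_measure PiE_def)
  have fin: "finite (states A)" "finite (symbols A)"
    using A by (auto simp: stochastic_CA_def)
  have coord: "(\<lambda>s. s y) \<in> measurable ?M (count_space (symbols A))" for y
  proof -
    have "(\<lambda>s. s y) \<in> measurable ?M (uniform_count_measure (symbols A))"
      unfolding symbol_measure_def by (rule measurable_component_singleton) simp
    moreover have "sets (uniform_count_measure (symbols A)) = sets (count_space (symbols A))"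
      by (simp add: sets_uniform_count_measure)
    ultimately show ?thesis
      using measurable_cong_sets[OF refl] by blast
  qed
  have closed: "explicit_global A c s z \<in> states A" if "s \<in> space ?M" for s z
  proof -
    have "set (map (\<lambda>v. c (z + v)) (nbh A)) \<subseteq> states A"
      "set (map (\<lambda>v. s (z + v)) ?V) \<subseteq> symbols A"
      using c that spM by (auto simp: Pi_iff)
    then show ?thesis
      using A unfolding stochastic_CA_def explicit_global_def by (metis length_map)
  qed
  have "(\<lambda>s. explicit_global A c s z) \<in> measurable ?M (count_space (states A))" for z
  proof (subst measurable_count_space_eq2[OF fin(1)], intro conjI ballI)
    show "(\<lambda>s. explicit_global A c s z) \<in> space ?M \<rightarrow> states A"
      using closed by auto
    fix a assume "a \<in> states A"
    define L where "L = {rs. set rs \<subseteq> symbols A \<and> length rs = length ?V \<and>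
      rule A (map (\<lambda>v. c (z + v)) (nbh A)) rs = a}"
    have finL: "finite L"
      by (rule finite_subset[OF _ finite_lists_length_eq[OF fin(2), of "length ?V"]])
        (auto simp: L_def)
    have eq: "(\<lambda>s. explicit_global A c s z) -` {a} \<inter> space ?M =
      (\<Union>rs\<in>L. {s \<in> space ?M. \<forall>i\<in>{..<length ?V}. s (z + ?V ! i) = rs ! i})"
      (is "?l = ?r")
    proof
      show "?l \<subseteq> ?r"
      proof
        fix s assume s: "s \<in> ?l"
        then have "map (\<lambda>v. s (z + v)) ?V \<in> L"
          using spM by (auto simp: L_def explicit_global_def Pi_iff)
        with s show "s \<in> ?r"
          by (auto intro!: bexI[of _ "map (\<lambda>v. s (z + v)) ?V"])
      qed
      show "?r \<subseteq> ?l"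
      proof
        fix s assume "s \<in> ?r"
        then obtain rs where rs: "rs \<in> L" "s \<in> space ?M"
          "\<forall>i<length ?V. s (z + ?V ! i) = rs ! i" by auto
        then have "map (\<lambda>v. s (z + v)) ?V = rs"
          by (auto simp: L_def intro!: nth_equalityI)
        with rs show "s \<in> ?l"
          by (auto simp: L_def explicit_global_def)
      qed
    qed
    have one: "{s \<in> space ?M. s y = b} \<in> sets ?M" for y b
    proof (cases "b \<in> symbols A")
      case True
      have "(\<lambda>s. s y) -` {b} \<inter> space ?M \<in> sets ?M"
        by (rule measurable_sets[OF coord]) (use True in auto)
      then show ?thesis by (simp add: vimage_def Int_def conj_commute)
    next
      case False
      then have "{s \<in> space ?M. s y = b} = {}" using spM by (auto simp: Pi_iff)
      then show ?thesis by (simp only: sets.empty_sets)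
    qed
    have "{s \<in> space ?M. \<forall>i\<in>{..<length ?V}. s (z + ?V ! i) = rs ! i} \<in> sets ?M" for rs
      by (rule sets.sets_Collect_finite_All) (auto intro: one)
    then show "(\<lambda>s. explicit_global A c s z) -` {a} \<inter> space ?M \<in> sets ?M"
      unfolding eq using finL by auto
  qed
  then show ?thesis
    unfolding config_space_def
    by (intro measurable_PiM_single') (auto simp: closed)
qed

lemma prob_space_stochastic_global:
  assumes A: "stochastic_CA A" and M: "stochastic_global A c = Some M"
  shows "prob_space M" "space M = UNIV \<rightarrow> states A"
proof -
  have c: "c \<in> UNIV \<rightarrow> states A"
    and M': "M = distr (symbol_measure A) (config_space A) (explicit_global A c)"
    using M by (auto simp: stochastic_global_def split: if_splits)
  have "prob_space (uniform_count_measure (symbols A))"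
    using A by (intro prob_space_uniform_count_measure) (auto simp: stochastic_CA_def)
  then have "prob_space (symbol_measure A)"
    unfolding symbol_measure_def by (intro prob_space_PiM)
  then show "prob_space M"
    unfolding M' by (rule prob_space.prob_space_distr) (rule measurable_explicit_global[OF A c])
  show "space M = UNIV \<rightarrow> states A"
    by (simp add: M' config_space_def space_PiM PiE_def)
qed

section \<open>Finite descriptions as inputs\<close>

text \<open>The local rule is given by its table, one entry per element of \<open>Q\<^sup>\<rho> \<times> R\<^sup>\<rho>\<^sup>'\<close>.\<close>

definition rule_table :: "sca \<Rightarrow> nat list" where
  "rule_table A =
     map (\<lambda>(qs, rs). list_encode [list_encode qs, list_encode rs, rule A qs rs])
       (List.product
         (List.n_lists (length (nbh A)) (sorted_list_of_set (states A)))
         (List.n_lists (length (symbol_nbh A)) (sorted_list_of_set (symbols A))))"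

definition sca_encode :: "sca \<Rightarrow> nat" where
  "sca_encode A = list_encode
     [list_encode (sorted_list_of_set (states A)),
      list_encode (sorted_list_of_set (symbols A)),
      list_encode (map int_encode (nbh A)),
      list_encode (map int_encode (symbol_nbh A)),
      list_encode (rule_table A)]"

section \<open>Algorithms: partial recursive functions\<close>

datatype recf =
    Zero
  | Succ
  | Proj nat
  | Comp recf "recf list"
  | PrimRec recf recf
  | Mu recf

text \<open>
  \<open>computes p xs y\<close>: program \<open>p\<close> halts on the arguments \<open>xs\<close> with result \<open>y\<close>. The recursion and
  search variables come first in the argument list.
\<close>

inductive computes :: "recf \<Rightarrow> nat list \<Rightarrow> nat \<Rightarrow> bool" where
  zero: "computes Zero xs 0"
| succ: "computes Succ [x] (Suc x)"
| proj: "i < length xs \<Longrightarrow> computes (Proj i) xs (xs ! i)"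
| comp: "list_all2 (\<lambda>g y. computes g xs y) gs ys \<Longrightarrow> computes f ys z \<Longrightarrow> computes (Comp f gs) xs z"
| primrec_0: "computes f xs y \<Longrightarrow> computes (PrimRec f g) (0 # xs) y"
| primrec_Suc: "computes (PrimRec f g) (n # xs) y \<Longrightarrow> computes g (n # y # xs) z \<Longrightarrow>
    computes (PrimRec f g) (Suc n # xs) z"
| mu: "computes f (n # xs) 0 \<Longrightarrow> (\<forall>m<n. \<exists>y>0. computes f (m # xs) y) \<Longrightarrow> computes (Mu f) xs n"

inductive_cases computes_zeroE: "computes Zero xs y"
inductive_cases computes_succE: "computes Succ xs y"
inductive_cases computes_projE: "computes (Proj i) xs y"
inductive_cases computes_compE: "computes (Comp f gs) xs y"
inductive_cases computes_primrec_0E: "computes (PrimRec f g) (0 # xs) y"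
inductive_cases computes_primrec_SucE: "computes (PrimRec f g) (Suc n # xs) y"
inductive_cases computes_muE: "computes (Mu f) xs y"

lemma computes_deterministic: "computes p xs y \<Longrightarrow> computes p xs z \<Longrightarrow> y = z"
proof (induction arbitrary: z rule: computes.induct)
  case (zero xs)
  then show ?case by (blast elim: computes_zeroE)
next
  case (succ x)
  then show ?case by (blast elim: computes_succE)
next
  case (proj i xs)
  then show ?case by (blast elim: computes_projE)
next
  case (comp xs gs ys f u)
  from comp.prems obtain ys' where
    ys': "list_all2 (\<lambda>g y. computes g xs y) gs ys'" "computes f ys' z"
    by (rule computes_compE)
  have "ys = ys'"
    using comp.IH(1) ys'(1) by (simp add: list_all2_conv_all_nth nth_equalityI)
  with comp.IH(2) ys'(2) show ?case by blast
next
  case (primrec_0 f xs y g)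
  then show ?case by (blast elim: computes_primrec_0E)
next
  case (primrec_Suc f g n xs y u)
  then show ?case by (blast elim: computes_primrec_SucE)
next
  case (mu f n xs)
  from mu.prems have z: "computes f (z # xs) 0" "\<forall>m<z. \<exists>y>0. computes f (m # xs) y"
    by (rule computes_muE, blast)+
  show ?case
  proof (rule linorder_cases[of n z])
    assume "n < z"
    then obtain y where "y > 0" "computes f (n # xs) y" using z(2) by blast
    with mu.IH(1) show ?thesis by blast
  next
    assume "z < n"
    then obtain y where "y > 0" "\<forall>w. computes f (z # xs) w \<longrightarrow> y = w" using mu.IH(2) by blast
    with z(1) show ?thesis by blast
  qed
qed

end

theory Submission
  imports Defs "HOL-Library.Function_Algebras"
begin

text \<open>
  Let \<open>m\<close> bound the radii of both automata. By translation invariance, \<open>S\<^sub>F = S\<^sub>G\<close> iff for all \<open>n\<close>, all words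
  \<open>u\<close> of length \<open>n + 2m\<close> and \<open>w\<close> of length \<open>n\<close> over the common set of states, both automata produce \<open>w\<close>
  from \<open>u\<close> with the same probability. Reading \<open>u\<close> and \<open>w\<close> in parallel from left to right and remembering
  the last \<open>2m\<close> states and random symbols, a weighted automaton computes each of these probabilities.
  Two weighted automata with \<open>d\<close> states in total agree on all words as soon as they agree on
  those of length at most \<open>d\<close>, so finitely many equations between integers remain to be tested.
\<close>

section \<open>Total recursive functions\<close>

text \<open>Neighbouring output cells share random symbols, so the probability of a word is not a
  product over its cells; and as the two automata may use different random symbols, nothing can be
  matched symbol by symbol. What remains is linear algebra: the value vectors of words live in the
  functions on the \<open>d\<close> states, and a strictly increasing chain of subspaces there has
  at most \<open>d\<close> steps. This is the origin of the length bound. Here \<open>d\<close>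
  counts, over both automata, the pairs of \<open>2m\<close> remembered states and \<open>2m\<close>
  remembered symbols. The first \<open>2m\<close> states of \<open>u\<close> are not read as letters
  but fix the initial vector. The weighted automata only justify the bound. The procedure itself
  enumerates words as numbers, counts the random words that produce \<open>w\<close> from
  \<open>u\<close>, and compares two fractions by cross multiplication; all its loops are bounded in
  advance.\<close>

text \<open>
  The arguments \<open>x\<^sub>0, \<dots>, x\<^sub>k\<^sub>-\<^sub>1\<close> are presented as an environment \<open>e\<close> with \<open>e i = x\<^sub>i\<close>, so that binding a new
  first variable is the shift of \<open>e\<close> and bodies of sums and bounded quantifiers are handled by
  higher-order matching alone.
\<close>

definition recursive :: "nat \<Rightarrow> ((nat \<Rightarrow> nat) \<Rightarrow> nat) \<Rightarrow> bool" where
  "recursive k f \<longleftrightarrow> (\<exists>p. \<forall>e. computes p (map e [0..<k]) (f e))"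

abbreviation rec_pred :: "nat \<Rightarrow> ((nat \<Rightarrow> nat) \<Rightarrow> bool) \<Rightarrow> bool" where
  "rec_pred k P \<equiv> recursive k (\<lambda>e. of_bool (P e))"

lemma recursive_var: "i < k \<Longrightarrow> recursive k (\<lambda>e. e i)"
  unfolding recursive_def using computes.proj[of i "map _ [0..<k]"]
  by (intro exI[of _ "Proj i"] allI) force

lemma recursive_compose:
  assumes f: "recursive n f" and g: "\<forall>i<n. recursive k (g i)"
  shows "recursive k (\<lambda>e. f (\<lambda>i. g i e))"
proof -
  obtain p where p: "\<And>e. computes p (map e [0..<n]) (f e)"
    using f by (auto simp: recursive_def)
  obtain q where q: "\<And>i e. i < n \<Longrightarrow> computes (q i) (map e [0..<k]) (g i e)"
    using g unfolding recursive_def by metis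
  have "computes (Comp p (map q [0..<n])) (map e [0..<k]) (f (\<lambda>i. g i e))" for e
    by (rule computes.comp[OF _ p]) (auto simp: list_all2_conv_all_nth intro: q)
  then show ?thesis unfolding recursive_def by blast
qed

text \<open>This and the two variants below allow closure under an operation to be proved on the
  variables \<open>e 0\<close>, \<open>e 1\<close>, ... alone, so that the argument terms need not
  be shifted under the binders of a recursion.\<close>

lemma recursive_compose1:
  assumes "recursive 1 (\<lambda>e. f (e 0))" "recursive k a"
  shows "recursive k (\<lambda>e. f (a e))"
  by (rule recursive_compose[where n = 1 and f = "\<lambda>e. f (e 0)" and g = "\<lambda>i. a"]) (use assms in auto)

lemma recursive_compose2:
  assumes "recursive 2 (\<lambda>e. f (e 0) (e 1))" "recursive k a" "recursive k b"
  shows "recursive k (\<lambda>e. f (a e) (b e))"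
proof -
  have "\<forall>i<2. recursive k ([a, b] ! i)"
    using assms(2-) by (auto simp: less_Suc_eq numeral_eq_Suc)
  from recursive_compose[where f = "\<lambda>e. f (e 0) (e 1)" and g = "\<lambda>i. [a, b] ! i", OF assms(1) this]
  show ?thesis by simp
qed

lemma recursive_compose5:
  assumes "recursive 5 (\<lambda>e. f (e 0) (e 1) (e 2) (e 3) (e 4))"
    and "recursive k a" "recursive k b" "recursive k c" "recursive k d" "recursive k g"
  shows "recursive k (\<lambda>e. f (a e) (b e) (c e) (d e) (g e))"
proof -
  have "\<forall>i<5. recursive k ([a, b, c, d, g] ! i)"
    using assms(2-) by (auto simp: less_Suc_eq numeral_eq_Suc)
  from recursive_compose[where f = "\<lambda>e. f (e 0) (e 1) (e 2) (e 3) (e 4)"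
      and g = "\<lambda>i. [a, b, c, d, g] ! i", OF assms(1) this]
  show ?thesis by simp
qed

lemma recursive_Suc:
  assumes "recursive k a" shows "recursive k (\<lambda>e. Suc (a e))"
proof (rule recursive_compose1[OF _ assms])
  show "recursive 1 (\<lambda>e. Suc (e 0))"
    unfolding recursive_def by (auto intro: exI[of _ Succ] computes.succ)
qed

lemma recursive_const: "recursive k (\<lambda>e. n)"
proof (induction n)
  case 0
  show ?case unfolding recursive_def by (auto intro: computes.zero)
next
  case (Suc n)
  then show ?case by (rule recursive_Suc)
qed

lemma recursive_rec_nat:
  assumes A: "recursive k A"
    and S: "recursive (Suc (Suc k)) (\<lambda>e. S (e 0) (e 1) (\<lambda>i. e (Suc (Suc i))))"
    and N: "recursive k N"
  shows "recursive k (\<lambda>e. rec_nat (A e) (\<lambda>n y. S n y e) (N e))"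
proof -
  obtain p q r where p: "\<And>e. computes p (map e [0..<k]) (A e)"
    and q: "\<And>e. computes q (map e [0..<Suc (Suc k)]) (S (e 0) (e 1) (\<lambda>i. e (Suc (Suc i))))"
    and r: "\<And>e. computes r (map e [0..<k]) (N e)"
    using assms unfolding recursive_def by metis
  have loop: "computes (PrimRec p q) (n # map e [0..<k]) (rec_nat (A e) (\<lambda>n y. S n y e) n)"
    for n e
  proof (induction n)
    case 0
    show ?case by (simp add: computes.primrec_0 p)
  next
    case (Suc n)
    let ?y = "rec_nat (A e) (\<lambda>n y. S n y e) n"
    let ?e = "\<lambda>i. case i of 0 \<Rightarrow> n | Suc j \<Rightarrow> (case j of 0 \<Rightarrow> ?y | Suc l \<Rightarrow> e l)"
    have "map ?e [0..<Suc (Suc k)] = n # ?y # map e [0..<k]"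
      by (simp add: upt_conv_Cons map_Suc_upt[symmetric] comp_def del: upt_Suc)
    with q[of ?e] have "computes q (n # ?y # map e [0..<k]) (S n ?y e)" by simp
    with Suc show ?case by (simp add: computes.primrec_Suc)
  qed
  \<comment> \<open>The number of iterations is computed from the arguments; the projections hand
    the arguments on as parameters.\<close>
  have "computes (Comp (PrimRec p q) (r # map Proj [0..<k])) (map e [0..<k])
      (rec_nat (A e) (\<lambda>n y. S n y e) (N e))" for e
    by (rule computes.comp[OF _ loop])
      (use computes.proj[of _ "map e [0..<k]"] in \<open>auto simp: list_all2_conv_all_nth nth_Cons r split: nat.split\<close>)
  then show ?thesis unfolding recursive_def by blast
qed

lemma recursive_add:
  assumes "recursive k a" "recursive k b" shows "recursive k (\<lambda>e. a e + b e)"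
proof -
  have "rec_nat x (\<lambda>n y. Suc y) n = x + n" for x n by (induction n) auto
  then show ?thesis
    using recursive_rec_nat[OF assms(1) _ assms(2), of "\<lambda>n y e. Suc y"]
    by (simp add: recursive_Suc recursive_var)
qed

lemma recursive_mult:
  assumes "recursive k a" "recursive k b" shows "recursive k (\<lambda>e. a e * b e)"
proof (rule recursive_compose2[OF _ assms])
  have "rec_nat 0 (\<lambda>n y. y + x) n = x * n" for x n :: nat by (induction n) auto
  then show "recursive 2 (\<lambda>e. e 0 * e 1)"
    using recursive_rec_nat[of 2 "\<lambda>e. 0" "\<lambda>n y e. y + e 0" "\<lambda>e. e 1"]
    by (simp add: recursive_add recursive_var recursive_const)
qed

lemma recursive_diff:
  assumes "recursive k a" "recursive k b" shows "recursive k (\<lambda>e. a e - b e)"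
proof (rule recursive_compose2[OF _ assms])
  \<comment> \<open>Ignoring the accumulator and returning the counter of the last iteration yields
    the predecessor; truncated subtraction iterates it.\<close>
  have "rec_nat 0 (\<lambda>n y. n) n = n - 1" for n by (cases n) auto
  then have pred: "recursive k (\<lambda>e. a e - 1)" if "recursive k a" for k a
    using recursive_rec_nat[OF recursive_const _ that, of "\<lambda>n y e. n" 0]
    by (simp add: recursive_var)
  have "rec_nat x (\<lambda>n y. y - 1) n = x - n" for x n :: nat by (induction n) auto
  then show "recursive 2 (\<lambda>e. e 0 - e 1)"
    using recursive_rec_nat[of 2 "\<lambda>e. e 0" "\<lambda>n y e. y - 1" "\<lambda>e. e 1"]
    by (simp add: recursive_var pred[simplified])
qed

lemma recursive_power:
  assumes "recursive k a" "recursive k b" shows "recursive k (\<lambda>e. a e ^ b e)"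
proof (rule recursive_compose2[OF _ assms])
  have "rec_nat 1 (\<lambda>n y. y * x) n = x ^ n" for x n :: nat by (induction n) auto
  then show "recursive 2 (\<lambda>e. e 0 ^ e 1)"
    using recursive_rec_nat[of 2 "\<lambda>e. 1" "\<lambda>n y e. y * e 0" "\<lambda>e. e 1"]
    by (simp add: recursive_mult recursive_var recursive_const)
qed

lemma recursive_sum:
  assumes B: "recursive k B" and F: "recursive (Suc k) (\<lambda>e. F (e 0) (\<lambda>i. e (Suc i)))"
  shows "recursive k (\<lambda>e. \<Sum>i<B e. F i e)"
proof -
  have "rec_nat 0 (\<lambda>n y. y + F n e) n = (\<Sum>i<n. F i e)" for n e by (induction n) auto
  moreover have "recursive (Suc (Suc k)) (\<lambda>e. F (e 0) (\<lambda>i. e (Suc (Suc i))))"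
  proof -
    \<comment> \<open>In the recursion, variable 1 is the accumulator, which \<open>F\<close> must
      skip; \<open>?g\<close> renames the variables accordingly.\<close>
    let ?g = "\<lambda>i e. case i of 0 \<Rightarrow> e 0 | Suc j \<Rightarrow> e (Suc (Suc j))"
    have "\<forall>i<Suc k. recursive (Suc (Suc k)) (?g i)"
      by (auto intro: recursive_var simp: less_Suc_eq_0_disj)
    from recursive_compose[where f = "\<lambda>e. F (e 0) (\<lambda>i. e (Suc i))" and g = ?g, OF F this] show ?thesis by simp
  qed
  ultimately show ?thesis
    using recursive_rec_nat[OF recursive_const _ B, of "\<lambda>n y e. y + F n e" 0]
    by (simp add: recursive_add recursive_var)
qed


section \<open>Decidable predicates: connectives, comparisons, bounded quantifiers\<close>

lemma rec_pred_not: "rec_pred k P \<Longrightarrow> rec_pred k (\<lambda>e. \<not> P e)"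
proof -
  assume P: "rec_pred k P"
  have "of_bool (\<not> P e) = 1 - (of_bool (P e) :: nat)" for e by simp
  then show ?thesis using recursive_diff[OF recursive_const P, of 1] by simp
qed

lemma rec_pred_conj: "rec_pred k P \<Longrightarrow> rec_pred k Q \<Longrightarrow> rec_pred k (\<lambda>e. P e \<and> Q e)"
  using recursive_mult[of k "\<lambda>e. of_bool (P e)" "\<lambda>e. of_bool (Q e)"]
  by (simp add: of_bool_conj)

lemma rec_pred_imp:
  assumes "rec_pred k P" "rec_pred k Q" shows "rec_pred k (\<lambda>e. P e \<longrightarrow> Q e)"
proof -
  have "(P e \<longrightarrow> Q e) \<longleftrightarrow> \<not> (P e \<and> \<not> Q e)" for e by blast
  then show ?thesis by (simp only:) (intro rec_pred_not rec_pred_conj assms)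
qed

lemma rec_pred_less:
  assumes "recursive k a" "recursive k b" shows "rec_pred k (\<lambda>e. a e < b e)"
proof -
  have "of_bool (a e < b e) = 1 - (1 - (b e - a e))" for e by (auto simp: of_bool_def)
  then show ?thesis by (simp only:) (intro recursive_diff recursive_const assms)
qed

lemma rec_pred_le:
  assumes "recursive k a" "recursive k b" shows "rec_pred k (\<lambda>e. a e \<le> b e)"
  unfolding not_less[symmetric] by (intro rec_pred_not rec_pred_less assms)

lemma rec_pred_eq:
  assumes "recursive k a" "recursive k b" shows "rec_pred k (\<lambda>e. a e = b e)"
  unfolding eq_iff[of "a _"] by (intro rec_pred_conj rec_pred_le assms)

lemma recursive_if:
  assumes "rec_pred k P" "recursive k a" "recursive k b"
  shows "recursive k (\<lambda>e. if P e then a e else b e)"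
proof -
  have "(if P e then a e else b e) = of_bool (P e) * a e + of_bool (\<not> P e) * b e" for e by simp
  then show ?thesis
    by (simp only:) (intro recursive_add recursive_mult rec_pred_not assms)
qed

lemma rec_pred_bex:
  assumes "recursive k B" "rec_pred (Suc k) (\<lambda>e. P (e 0) (\<lambda>i. e (Suc i)))"
  shows "rec_pred k (\<lambda>e. \<exists>i<B e. P i e)"
proof -
  have "(\<exists>i<B e. P i e) \<longleftrightarrow> 0 < (\<Sum>i<B e. of_bool (P i e) :: nat)" for e
    by (auto simp: zero_less_iff_neq_zero)
  then show ?thesis
    by (simp only:) (intro rec_pred_less recursive_const recursive_sum assms)
qed

lemma rec_pred_ball:
  assumes "recursive k B" "rec_pred (Suc k) (\<lambda>e. P (e 0) (\<lambda>i. e (Suc i)))"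
  shows "rec_pred k (\<lambda>e. \<forall>i<B e. P i e)"
proof -
  have "(\<forall>i<B e. P i e) \<longleftrightarrow> \<not> (\<exists>i<B e. \<not> P i e)" for e by blast
  then show ?thesis
    by (simp only:) (intro rec_pred_not rec_pred_bex assms)
qed

lemmas recursive_intros = recursive_var recursive_const recursive_Suc recursive_add recursive_mult
  recursive_diff recursive_power recursive_sum recursive_if rec_pred_not rec_pred_conj rec_pred_imp
  rec_pred_less rec_pred_le rec_pred_eq rec_pred_bex rec_pred_ball

lemma recursive_div:
  assumes "recursive k a" "recursive k b" shows "recursive k (\<lambda>e. a e div b e)"
proof (rule recursive_compose2[OF _ assms])
  \<comment> \<open>The quotient counts the positive multiples of \<open>y\<close> up to
    \<open>x\<close>; the conjunct \<open>0 < y\<close> yields \<open>x div 0 = 0\<close>.\<close>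
  have "x div y = (\<Sum>i<x. of_bool (0 < y \<and> Suc i * y \<le> x))" for x y :: nat
  proof (cases "y = 0")
    case False
    then have "{..<x} \<inter> {i. 0 < y \<and> Suc i * y \<le> x} = {..<x div y}"
      by (auto simp: less_eq_div_iff_mult_less_eq[symmetric] Suc_le_eq simp del: mult_Suc
          intro: less_le_trans[OF _ div_le_dividend])
    then show ?thesis by (simp add: of_bool_def sum.If_cases)
  qed simp
  then show "recursive 2 (\<lambda>e. e 0 div e 1)"
    by (simp only:) (intro recursive_intros; simp)
qed

lemma recursive_mod:
  assumes "recursive k a" "recursive k b" shows "recursive k (\<lambda>e. a e mod b e)"
  unfolding modulo_nat_def by (intro recursive_intros recursive_div assms)

section \<open>Equivalence of weighted automata\<close>

text \<open>All final weights are 1 and initial weights are left out: the value of a word is a whole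
  vector, so that prepending a letter acts as a linear map. Vanishing off \<open>S\<close> keeps
  these vectors in a space of dimension \<open>card S\<close>.\<close>

primrec wa_value :: "'s set \<Rightarrow> ('l \<Rightarrow> 's \<Rightarrow> 's \<Rightarrow> real) \<Rightarrow> 'l list \<Rightarrow> 's \<Rightarrow> real" where
  "wa_value S T [] = indicator S"
| "wa_value S T (l # x) = (\<lambda>s. if s \<in> S then \<Sum>s'\<in>S. T l s s' * wa_value S T x s' else 0)"

interpretation fun_space: vector_space "\<lambda>(a::real) (f :: 'a \<Rightarrow> real) x. a * f x"
  by unfold_locales (auto simp: fun_eq_iff algebra_simps)

text \<open>A vector outside the span of its predecessors extends an independent set and differs
  from each of them. Injectivity is recorded because the dimension bound counts the image, not the
  indices.\<close>

lemma independent_of_escaping: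
  fixes k :: nat
  assumes esc: "\<And>i. i < k \<Longrightarrow> v i \<notin> fun_space.span (v ` {..<i})"
  shows "\<not> fun_space.dependent (v ` {..<k}) \<and> inj_on v {..<k}"
  using esc
proof (induction k)
  case 0
  then show ?case by (simp add: fun_space.dependent_def)
next
  case (Suc k)
  then have ni: "v k \<notin> fun_space.span (v ` {..<k})" by simp
  then have "v k \<notin> v ` {..<k}" using fun_space.span_base[of "v k" "v ` {..<k}"] by argo
  with ni Suc show ?case
    by (auto simp: lessThan_Suc fun_space.independent_insert inj_on_insert)
qed

text \<open>The spans of the value vectors of the words of length at most \<open>k\<close> increase with \<open>k\<close>, all inside
  a space of dimension \<open>card S\<close>, and once they stop growing they are invariant under the letters.\<close>

lemma wa_value_bounded_span:
  assumes S: "finite S" and x: "set x \<subseteq> L"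
  shows "wa_value S T x \<in> fun_space.span (wa_value S T ` {y. set y \<subseteq> L \<and> length y \<le> card S})"
proof -
  define W where "W k = fun_space.span (wa_value S T ` {y. set y \<subseteq> L \<and> length y \<le> k})" for k
  have W_mono: "W i \<subseteq> W j" if "i \<le> j" for i j
    unfolding W_def using that by (intro fun_space.span_mono) auto
  define unit where "unit s = (\<lambda>t. of_bool (t = s) :: real)" for s :: 'a
  have unit_span: "h \<in> fun_space.span (unit ` S)" if "\<And>s. s \<notin> S \<Longrightarrow> h s = 0" for h
  proof -
    have "h = (\<Sum>s\<in>S. (\<lambda>t. h s * unit s t))"
    proof
      fix t
      have *: "sum F A t = (\<Sum>s\<in>A. F s t)" if "finite A" for F :: "'a \<Rightarrow> 'a \<Rightarrow> real" and A
        using that by induction auto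
      show "h t = (\<Sum>s\<in>S. (\<lambda>t. h s * unit s t)) t"
        using S that by (cases "t \<in> S") (auto simp: * unit_def of_bool_def sum.delta if_distrib cong: if_cong)
    qed
    also have "\<dots> \<in> fun_space.span (unit ` S)"
      by (intro fun_space.span_sum fun_space.span_scale fun_space.span_base) auto
    finally show ?thesis .
  qed
  have val_span: "wa_value S T y \<in> fun_space.span (unit ` S)" for y
    by (rule unit_span) (cases y; simp)
  \<comment> \<open>Otherwise every \<open>k\<close> up to \<open>card S\<close> supplies a word of
    length at most \<open>k + 1\<close> whose vector escapes \<open>W k\<close>. Taken in order,
    these \<open>card S + 1\<close> vectors are independent, yet they lie in the span of at most
    \<open>card S\<close> unit vectors.\<close>
  have "\<exists>k\<le>card S. \<forall>y. set y \<subseteq> L \<and> length y \<le> Suc k \<longrightarrow> wa_value S T y \<in> W k"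
  proof (rule ccontr)
    assume "\<not> ?thesis"
    then have "\<forall>k\<le>card S. \<exists>y. set y \<subseteq> L \<and> length y \<le> Suc k \<and> wa_value S T y \<notin> W k" by blast
    then obtain y where y: "\<And>k. k \<le> card S \<Longrightarrow>
        set (y k) \<subseteq> L \<and> length (y k) \<le> Suc k \<and> wa_value S T (y k) \<notin> W k" by metis
    define v where "v k = wa_value S T (y k)" for k
    have "v i \<notin> fun_space.span (v ` {..<i})" if "i < Suc (card S)" for i
    proof -
      have "v j \<in> W i" if "j < i" for j
        using y[of j] that \<open>i < Suc (card S)\<close>
        unfolding v_def W_def by (intro fun_space.span_base) auto
      then have "fun_space.span (v ` {..<i}) \<subseteq> W i"
        unfolding W_def by (intro fun_space.span_minimal) auto
      then show ?thesis using y[of i] that by (auto simp: v_def)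
    qed
    then have "\<not> fun_space.dependent (v ` {..<Suc (card S)})" "inj_on v {..<Suc (card S)}"
      using independent_of_escaping[of "Suc (card S)" v] by auto
    moreover have "v ` {..<Suc (card S)} \<subseteq> fun_space.span (unit ` S)"
      using val_span by (auto simp: v_def)
    ultimately have "card (v ` {..<Suc (card S)}) \<le> card (unit ` S)"
      using fun_space.independent_span_bound[of "unit ` S"] S by blast
    also have "\<dots> \<le> card S" using S by (rule card_image_le)
    finally show False using \<open>inj_on v _\<close> by (simp add: card_image)
  qed
  then obtain k where k: "k \<le> card S"
    and stable: "\<And>y. set y \<subseteq> L \<Longrightarrow> length y \<le> Suc k \<Longrightarrow> wa_value S T y \<in> W k" by blast
  \<comment> \<open>By linearity it suffices to treat generators: prolonging a word of length at
    most \<open>k\<close> by one letter gives length at most \<open>k + 1\<close>, where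
    \<open>stable\<close> applies.\<close>
  have step: "(\<lambda>s. if s \<in> S then \<Sum>s'\<in>S. T l s s' * h s' else 0) \<in> W k"
    if l: "l \<in> L" and h: "h \<in> W k" for l h
    using h unfolding W_def
  proof (induction rule: fun_space.span_induct_alt)
    case base
    then show ?case using fun_space.span_zero by (simp add: zero_fun_def cong: if_cong)
  next
    case (step c g h)
    then obtain y where y: "set y \<subseteq> L" "length y \<le> k" "g = wa_value S T y" by auto
    have "wa_value S T (l # y) \<in> W k" using y l by (intro stable) auto
    then have "(\<lambda>s. c * wa_value S T (l # y) s) + (\<lambda>s. if s \<in> S then \<Sum>s'\<in>S. T l s s' * h s' else 0) \<in> W k"
      using step(2) unfolding W_def by (intro fun_space.span_add fun_space.span_scale)
    moreover have "(\<lambda>s. c * wa_value S T (l # y) s) + (\<lambda>s. if s \<in> S then \<Sum>s'\<in>S. T l s s' * h s' else 0)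
      = (\<lambda>s. if s \<in> S then \<Sum>s'\<in>S. T l s s' * ((\<lambda>x. c * g x) + h) s' else 0)"
      by (auto simp: fun_eq_iff y(3) sum_distrib_left sum.distrib algebra_simps)
    ultimately show ?case by (simp add: W_def)
  qed
  have "wa_value S T x \<in> W k" using x
  proof (induction x)
    case Nil
    then show ?case by (intro stable) auto
  next
    case (Cons l x)
    then show ?case unfolding wa_value.simps by (intro step) auto
  qed
  then show ?thesis using W_mono[OF k] unfolding W_def by blast
qed

text \<open>A linear functional vanishing on the vectors of the short words vanishes on their span,
  hence on all value vectors. For the comparison of two automata, \<open>a\<close> carries opposite
  signs on their states.\<close>

lemma wa_equivalence_bound:
  assumes S: "finite S"
    and short: "\<And>y. set y \<subseteq> L \<Longrightarrow> length y \<le> card S \<Longrightarrow> (\<Sum>s\<in>S. a s * wa_value S T y s) = 0"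
    and x: "set x \<subseteq> L"
  shows "(\<Sum>s\<in>S. a s * wa_value S T x s) = 0"
  using wa_value_bounded_span[OF S x, of T]
proof (induction rule: fun_space.span_induct_alt)
  case base
  then show ?case by simp
next
  case (step c g h)
  then have "(\<Sum>s\<in>S. a s * g s) = 0" using short by auto
  moreover have "(\<Sum>s\<in>S. a s * ((\<lambda>x. c * g x) + h) s) = c * (\<Sum>s\<in>S. a s * g s) + (\<Sum>s\<in>S. a s * h s)"
    by (simp add: sum_distrib_left sum.distrib algebra_simps)
  ultimately show ?case using step(2) by simp
qed

section \<open>Words and their codes\<close>

lemma recursive_triangle: "recursive k a \<Longrightarrow> recursive k (\<lambda>e. triangle (a e))"
  unfolding triangle_def by (intro recursive_intros recursive_div)

text \<open>The code of \<open>(i, j)\<close> is \<open>triangle (i + j) + i\<close> and bounds both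
  components, so a bounded search finds the pair. By injectivity of the coding exactly one summand
  is selected, and the sum returns it.\<close>

lemma recursive_fst_prod_decode:
  assumes "recursive k a" shows "recursive k (\<lambda>e. fst (prod_decode (a e)))"
proof (rule recursive_compose1[OF _ assms])
  have "fst (prod_decode x) = (\<Sum>i<Suc x. if \<exists>j<Suc x. triangle (i + j) + i = x then i else 0)" for x
  proof -
    obtain p q where x: "x = prod_encode (p, q)" by (metis prod_decode_inverse surj_pair)
    have "(\<exists>j<Suc x. triangle (i + j) + i = x) \<longleftrightarrow> i = p" for i
    proof -
      have "triangle (i + j) + i = x \<longleftrightarrow> (i, j) = (p, q)" for j
        using prod_encode_eq[of "(i, j)" "(p, q)"] by (simp add: x prod_encode_def)
      then show ?thesis using le_prod_encode_2[of q p] by (auto simp: x less_Suc_eq_le)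
    qed
    then show ?thesis using le_prod_encode_1[of p q] by (simp add: x)
  qed
  then show "recursive 1 (\<lambda>e. fst (prod_decode (e 0)))"
    by (simp only:) (intro recursive_intros recursive_triangle; simp)
qed

lemma recursive_snd_prod_decode:
  assumes "recursive k a" shows "recursive k (\<lambda>e. snd (prod_decode (a e)))"
proof (rule recursive_compose1[OF _ assms])
  have "snd (prod_decode x) = (\<Sum>j<Suc x. if \<exists>i<Suc x. triangle (i + j) + i = x then j else 0)" for x
  proof -
    obtain p q where x: "x = prod_encode (p, q)" by (metis prod_decode_inverse surj_pair)
    have "(\<exists>i<Suc x. triangle (i + j) + i = x) \<longleftrightarrow> j = q" for j
    proof -
      have "triangle (i + j) + i = x \<longleftrightarrow> (i, j) = (p, q)" for i
        using prod_encode_eq[of "(i, j)" "(p, q)"] by (simp add: x prod_encode_def)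
      then show ?thesis using le_prod_encode_1[of p q] by (auto simp: x less_Suc_eq_le)
    qed
    then show ?thesis using le_prod_encode_2[of q p] by (simp add: x)
  qed
  then show "recursive 1 (\<lambda>e. snd (prod_decode (e 0)))"
    by (simp only:) (intro recursive_intros recursive_triangle; simp)
qed

text \<open>Since \<open>prod_decode 0 = (0, 0)\<close>, the tail of the code \<open>0\<close> of the empty list is again \<open>0\<close>.\<close>

definition code_drop :: "nat \<Rightarrow> nat \<Rightarrow> nat" where
  "code_drop k x = rec_nat x (\<lambda>_ y. snd (prod_decode (y - 1))) k"

text \<open>The code of a nonempty list is the successor of the code of a pair, whence the
  subtraction of 1. Past the end of the list the value is 0.\<close>

definition code_nth :: "nat \<Rightarrow> nat \<Rightarrow> nat" where
  "code_nth x k = fst (prod_decode (code_drop k x - 1))"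

text \<open>On a list code, \<open>code_drop j x \<noteq> 0\<close> says that position
  \<open>j\<close> exists. The code is at least the length, so it can serve as bound of the
  quantifier.\<close>

definition code_member :: "nat \<Rightarrow> nat \<Rightarrow> bool" where
  "code_member y x \<longleftrightarrow> (\<exists>j<x. code_drop j x \<noteq> 0 \<and> code_nth x j = y)"

lemma code_drop_list_encode: "code_drop k (list_encode xs) = list_encode (drop k xs)"
proof (induction k)
  case 0
  show ?case by (simp add: code_drop_def)
next
  case (Suc k)
  have "prod_decode 0 = (0, 0)" using prod_encode_inverse[of "(0, 0)"] by (simp add: prod_encode_def)
  then have "snd (prod_decode (list_encode ys - 1)) = list_encode (tl ys)" for ys
    by (cases ys) auto
  with Suc show ?case by (simp add: code_drop_def drop_Suc tl_drop)
qed

lemma list_encode_eq_0: "list_encode xs = 0 \<longleftrightarrow> xs = []"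
  by (cases xs) auto

lemma code_drop_eq_0: "code_drop k (list_encode xs) = 0 \<longleftrightarrow> length xs \<le> k"
  by (simp add: code_drop_list_encode list_encode_eq_0)

lemma code_nth_list_encode: "k < length xs \<Longrightarrow> code_nth (list_encode xs) k = xs ! k"
  by (simp add: code_nth_def code_drop_list_encode Cons_nth_drop_Suc[symmetric])

lemma length_le_list_encode: "length xs \<le> list_encode xs"
proof (induction xs)
  case (Cons x xs)
  then show ?case using le_prod_encode_2[of "list_encode xs" x] by simp
qed simp

lemma member_less_list_encode: "x \<in> set xs \<Longrightarrow> x < list_encode xs"
proof (induction xs)
  case (Cons y xs)
  then show ?case using le_prod_encode_1[of y "list_encode xs"] le_prod_encode_2[of "list_encode xs" y]
    by auto
qed simp

lemma code_member_list_encode: "code_member y (list_encode xs) \<longleftrightarrow> y \<in> set xs"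
  unfolding code_member_def code_drop_eq_0 not_le
  using length_le_list_encode[of xs]
  by (auto simp: code_nth_list_encode in_set_conv_nth intro: less_le_trans)

lemma recursive_code_drop:
  "recursive k a \<Longrightarrow> recursive k b \<Longrightarrow> recursive k (\<lambda>e. code_drop (a e) (b e))"
  unfolding code_drop_def
  by (intro recursive_rec_nat recursive_snd_prod_decode recursive_intros; simp)

lemma recursive_code_nth:
  "recursive k a \<Longrightarrow> recursive k b \<Longrightarrow> recursive k (\<lambda>e. code_nth (a e) (b e))"
  unfolding code_nth_def
  by (intro recursive_fst_prod_decode recursive_code_drop recursive_intros)

lemma rec_pred_code_member:
  assumes "recursive k a" "recursive k b" shows "rec_pred k (\<lambda>e. code_member (a e) (b e))"
proof (rule recursive_compose2[OF _ assms])
  show "rec_pred 2 (\<lambda>e. code_member (e 0) (e 1))"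
    unfolding code_member_def
    by (intro recursive_code_drop recursive_code_nth recursive_intros; simp)
qed

section \<open>Words of fixed length as numbers in base \<open>b\<close>\<close>

definition digit :: "nat \<Rightarrow> nat \<Rightarrow> nat \<Rightarrow> nat" where
  "digit b x i = x div b ^ i mod b"

lemma recursive_digit:
  "recursive k a \<Longrightarrow> recursive k b \<Longrightarrow> recursive k c \<Longrightarrow> recursive k (\<lambda>e. digit (a e) (b e) (c e))"
  unfolding digit_def by (intro recursive_div recursive_mod recursive_intros)

definition words :: "nat set \<Rightarrow> nat \<Rightarrow> nat list set" where
  "words S n = {t. set t \<subseteq> S \<and> length t = n}"

text \<open>In contrast to list codes, these numbers fill an initial segment: the words of length
  \<open>n\<close> over \<open>{..<b}\<close> correspond to the numbers below \<open>b ^ n\<close>,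
  which turns quantifying over words and counting them into bounded operations.\<close>

definition digits :: "nat \<Rightarrow> nat \<Rightarrow> nat \<Rightarrow> nat list" where
  "digits b n x = map (digit b x) [0..<n]"

lemma digits_Suc: "digits b (Suc n) x = x mod b # digits b n (x div b)"
proof -
  have "digit b x (Suc i) = digit b (x div b) i" for i
    by (simp add: digit_def div_mult2_eq)
  then show ?thesis
    by (simp add: digits_def upt_conv_Cons map_Suc_upt[symmetric] comp_def digit_def[of _ _ 0] del: upt_Suc)
qed

text \<open>Stripping the lowest digit gives injectivity by induction; surjectivity follows since
  both sides have \<open>b ^ n\<close> elements.\<close>

lemma bij_betw_digits:
  assumes "0 < b" shows "bij_betw (digits b n) {..<b ^ n} (words {..<b} n)"
proof -
  have "inj_on (digits b n) {..<b ^ n}"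
  proof (induction n)
    case (Suc n)
    show ?case
    proof (rule inj_onI)
      fix x y assume x: "x \<in> {..<b ^ Suc n}" and y: "y \<in> {..<b ^ Suc n}"
        and eq: "digits b (Suc n) x = digits b (Suc n) y"
      have "x div b < b ^ n" "y div b < b ^ n"
        using x y assms by (auto simp: div_less_iff_less_mult mult.commute)
      with Suc eq have "x div b = y div b" by (auto simp: digits_Suc dest: inj_onD)
      moreover have "x mod b = y mod b" using eq by (simp add: digits_Suc)
      ultimately show "x = y" by (metis div_mult_mod_eq)
    qed
  qed (simp add: inj_on_def)
  moreover have "digits b n ` {..<b ^ n} \<subseteq> words {..<b} n"
    using assms by (auto simp: digits_def words_def digit_def)
  moreover have "finite (words {..<b} n)" "card (words {..<b} n) = b ^ n"
    unfolding words_def using finite_lists_length_eq[of "{..<b}" n] card_lists_length_eq[of "{..<b}" n]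
    by auto
  ultimately show ?thesis
    by (auto simp: bij_betw_def card_image card_subset_eq)
qed

lemma words_subset: "S \<subseteq> T \<Longrightarrow> words S n \<subseteq> words T n"
  by (auto simp: words_def)

text \<open>The alphabet \<open>S\<close> may have gaps in \<open>{..<b}\<close>, so codes of words
  over \<open>S\<close> are singled out by a test on their digits.\<close>

lemma words_eq_digits_image:
  assumes "0 < b" "S \<subseteq> {..<b}"
  shows "words S n = digits b n ` {x. x < b ^ n \<and> digits b n x \<in> words S n}" (is "_ = ?r")
proof
  show "words S n \<subseteq> ?r"
  proof
    fix t assume t: "t \<in> words S n"
    then have "t \<in> digits b n ` {..<b ^ n}"
      using bij_betw_imp_surj_on[OF bij_betw_digits[OF assms(1), of n]] words_subset[OF assms(2), of n]
      by auto
    with t show "t \<in> ?r" by auto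
  qed
qed auto

lemma ball_words_digits:
  assumes "0 < b" "S \<subseteq> {..<b}"
  shows "(\<forall>t\<in>words S n. P t) \<longleftrightarrow> (\<forall>x<b ^ n. digits b n x \<in> words S n \<longrightarrow> P (digits b n x))"
  by (subst words_eq_digits_image[OF assms]) auto

lemma card_words_digits:
  assumes "0 < b" "S \<subseteq> {..<b}"
  shows "card {t \<in> words S n. P t} = card {x. x < b ^ n \<and> digits b n x \<in> words S n \<and> P (digits b n x)}"
proof -
  let ?X = "{x. x < b ^ n \<and> digits b n x \<in> words S n \<and> P (digits b n x)}"
  have "{t \<in> words S n. P t} = digits b n ` ?X"
    by (subst words_eq_digits_image[OF assms]) auto
  moreover have "inj_on (digits b n) ?X"
    using bij_betw_digits[OF assms(1), of n] by (auto simp: bij_betw_def intro: inj_on_subset)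
  ultimately show ?thesis by (simp add: card_image)
qed

lemma digits_in_words: "digits b n x \<in> words S n \<longleftrightarrow> (\<forall>i<n. digit b x i \<in> S)"
  by (auto simp: digits_def words_def)

section \<open>Word transition probabilities\<close>

definition nbh_bounded :: "sca \<Rightarrow> nat \<Rightarrow> bool" where
  "nbh_bounded A m \<longleftrightarrow> (\<forall>v \<in> set (nbh A) \<union> set (symbol_nbh A). \<bar>v\<bar> \<le> int m)"

text \<open>Position \<open>i\<close> of the output corresponds to position \<open>m + i\<close> of the input words.\<close>

definition local_map :: "sca \<Rightarrow> nat \<Rightarrow> nat list \<Rightarrow> nat list \<Rightarrow> nat" where
  "local_map A m u t = rule A (map (\<lambda>v. u ! nat (int m + v)) (nbh A))
     (map (\<lambda>v. t ! nat (int m + v)) (symbol_nbh A))"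

definition emits :: "sca \<Rightarrow> nat \<Rightarrow> nat list \<Rightarrow> nat list \<Rightarrow> nat list \<Rightarrow> bool" where
  "emits A m u t w \<longleftrightarrow> (\<forall>i<length w. local_map A m (drop i u) (drop i t) = w ! i)"

definition word_prob :: "sca \<Rightarrow> nat \<Rightarrow> nat list \<Rightarrow> nat list \<Rightarrow> real" where
  "word_prob A m u w =
     card {t \<in> words (symbols A) (length w + 2 * m). emits A m u t w} /
     card (symbols A) ^ (length w + 2 * m)"

lemma finite_words: "finite S \<Longrightarrow> finite (words S n)"
  unfolding words_def by (rule finite_lists_length_eq)

lemma card_words: "finite S \<Longrightarrow> card (words S n) = card S ^ n"
  unfolding words_def by (rule card_lists_length_eq)

lemma emits_Nil: "emits A m u t []"
  by (simp add: emits_def)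

lemma emits_Cons:
  "emits A m u t (b # w) \<longleftrightarrow> local_map A m u t = b \<and> emits A m (tl u) (tl t) w"
proof -
  have "(\<forall>i<Suc n. P i) \<longleftrightarrow> P 0 \<and> (\<forall>i<n. P (Suc i))" for P and n :: nat
    by (auto simp: less_Suc_eq_0_disj)
  then show ?thesis by (simp add: emits_def drop_Suc)
qed

text \<open>An offset \<open>v\<close> with absolute value at most \<open>m\<close> is read at
  position \<open>m + v\<close>, which lies between 0 and \<open>2m\<close>.\<close>

lemma local_map_append:
  assumes "nbh_bounded A m" "2 * m < length u" "2 * m < length t"
  shows "local_map A m (u @ u') (t @ t') = local_map A m u t"
proof -
  have "nat (int m + v) < length u" "nat (int m + v) < length t"
    if "v \<in> set (nbh A) \<union> set (symbol_nbh A)" for v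
  proof -
    have "\<bar>v\<bar> \<le> int m" using that assms(1) by (auto simp: nbh_bounded_def)
    then show "nat (int m + v) < length u" "nat (int m + v) < length t" using assms by linarith+
  qed
  then show ?thesis by (simp add: local_map_def nth_append cong: map_cong)
qed

lemma words_0: "words S 0 = {[]}"
  by (auto simp: words_def)

lemma words_Suc: "words S (Suc n) = (\<lambda>(r, t). r # t) ` (S \<times> words S n)"
  by (auto simp: words_def length_Suc_conv image_iff)

lemma words_add: "words S (m + n) = (\<lambda>(r, t). r @ t) ` (words S m \<times> words S n)"
proof (intro set_eqI iffI)
  fix t assume "t \<in> words S (m + n)"
  then have "take m t \<in> words S m" "drop m t \<in> words S n"
    by (auto simp: words_def dest: in_set_takeD in_set_dropD)
  then show "t \<in> (\<lambda>(r, t). r @ t) ` (words S m \<times> words S n)"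
    by (intro image_eqI[of _ _ "(take m t, drop m t)"]) auto
qed (auto simp: words_def)

lemma sum_words_Suc:
  "(\<Sum>t\<in>words S (Suc n). f t) = (\<Sum>r\<in>S. \<Sum>t\<in>words S n. f (r # t))"
  unfolding words_Suc by (subst sum.reindex) (auto simp: inj_on_def sum.cartesian_product split_def)

lemma sum_words_add:
  "(\<Sum>t\<in>words S (m + n). f t) = (\<Sum>r\<in>words S m. \<Sum>t\<in>words S n. f (r @ t))"
  unfolding words_add
  by (subst sum.reindex) (auto simp: inj_on_def words_def sum.cartesian_product split_def)

text \<open>
  The probability of emitting \<open>map snd x\<close> from \<open>\<kappa> @ map fst x\<close>, given that the first \<open>2m\<close> random symbols
  are \<open>\<rho>\<close>. It is the value of \<open>x\<close> in state \<open>(\<kappa>, \<rho>)\<close> of the weighted automaton.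
\<close>

definition ext_prob :: "sca \<Rightarrow> nat \<Rightarrow> (nat \<times> nat) list \<Rightarrow> nat list \<Rightarrow> nat list \<Rightarrow> real" where
  "ext_prob A m x \<kappa> \<rho> = (\<Sum>t\<in>words (symbols A) (length x).
     of_bool (emits A m (\<kappa> @ map fst x) (\<rho> @ t) (map snd x))) / card (symbols A) ^ length x"

text \<open>Conditioning on the first \<open>2m\<close> random symbols, which are uniform.\<close>

lemma word_prob_eq_ext_prob:
  assumes "finite (symbols A)"
  shows "word_prob A m (\<kappa> @ map fst x) (map snd x) =
    (\<Sum>\<rho>\<in>words (symbols A) (2 * m). ext_prob A m x \<kappa> \<rho>) / card (symbols A) ^ (2 * m)"
proof -
  let ?n = "length x" and ?S = "symbols A"
  have "real (card {t \<in> words ?S (?n + 2 * m). emits A m (\<kappa> @ map fst x) t (map snd x)}) =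
     (\<Sum>t\<in>words ?S (2 * m + ?n). of_bool (emits A m (\<kappa> @ map fst x) t (map snd x)))"
    using finite_words[OF assms] by (simp add: of_bool_def sum.If_cases Int_def add.commute conj_commute)
  then show ?thesis
    unfolding word_prob_def ext_prob_def sum_words_add
    by (simp add: sum_divide_distrib power_add)
qed

lemma ext_prob_Nil: "ext_prob A m [] \<kappa> \<rho> = 1"
  by (simp add: ext_prob_def words_0 emits_Nil)

text \<open>This is the transition of the weighted automaton. The first output letter is determined
  by \<open>\<kappa> @ [a]\<close> and \<open>\<rho> @ [r]\<close>; the later ones never look at the
  oldest state and symbol, which are therefore forgotten.\<close>

lemma ext_prob_Cons:
  assumes A: "nbh_bounded A m" "finite (symbols A)" and len: "length \<kappa> = 2 * m" "length \<rho> = 2 * m"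
  shows "ext_prob A m ((a, b) # x) \<kappa> \<rho> =
    (\<Sum>r\<in>symbols A. of_bool (local_map A m (\<kappa> @ [a]) (\<rho> @ [r]) = b) / card (symbols A) *
       ext_prob A m x (tl (\<kappa> @ [a])) (tl (\<rho> @ [r])))"
proof -
  let ?S = "symbols A"
  \<comment> \<open>The form \<open>tl (\<kappa> @ [a])\<close> also covers \<open>m = 0\<close>,
    where nothing is remembered; \<open>tl \<kappa> @ [a]\<close> would then have length 1.\<close>
  have tl: "tl (y @ c # z) = tl (y @ [c]) @ z" for y z :: "nat list" and c by (cases y) auto
  have "emits A m (\<kappa> @ a # map fst x) (\<rho> @ r # t) (b # map snd x) \<longleftrightarrow>
      local_map A m (\<kappa> @ [a]) (\<rho> @ [r]) = b \<and>
      emits A m (tl (\<kappa> @ [a]) @ map fst x) (tl (\<rho> @ [r]) @ t) (map snd x)" for r t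
    using local_map_append[OF A(1), of "\<kappa> @ [a]" "\<rho> @ [r]" "map fst x" t] len
    by (simp add: emits_Cons tl[of _ _ "map fst x"] tl[of _ _ t])
  then have "ext_prob A m ((a, b) # x) \<kappa> \<rho> = (\<Sum>r\<in>?S. \<Sum>t\<in>words ?S (length x).
      of_bool (local_map A m (\<kappa> @ [a]) (\<rho> @ [r]) = b) *
      of_bool (emits A m (tl (\<kappa> @ [a]) @ map fst x) (tl (\<rho> @ [r]) @ t) (map snd x)))
      / card ?S ^ Suc (length x)"
    by (simp add: ext_prob_def sum_words_Suc of_bool_conj)
  then show ?thesis
    by (simp add: ext_prob_def sum_distrib_left sum_divide_distrib)
qed

text \<open>Both automata are placed side by side in one weighted automaton, told apart by a Boolean
  tag. The difference of the two probabilities is then a single linear functional of the value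
  vector, so \<open>wa_equivalence_bound\<close> applies with the total number of states as
  bound.\<close>

lemma word_prob_eq_of_short:
  assumes bounded: "nbh_bounded A m" "nbh_bounded B m"
    and fin: "finite Q" "finite (symbols A)" "finite (symbols B)"
    and short: "\<And>n u w. n \<le> card Q ^ (2 * m) * (card (symbols A) ^ (2 * m) + card (symbols B) ^ (2 * m)) \<Longrightarrow>
      u \<in> words Q (n + 2 * m) \<Longrightarrow> w \<in> words Q n \<Longrightarrow> word_prob A m u w = word_prob B m u w"
    and u: "u \<in> words Q (n + 2 * m)" and w: "w \<in> words Q n"
  shows "word_prob A m u w = word_prob B m u w"
proof -
  define D where "D s = (if s then A else B)" for s
  define S where "S = (SIGMA s:UNIV. words Q (2 * m) \<times> words (symbols (D s)) (2 * m))"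
  \<comment> \<open>The sum over \<open>r\<close> merges symbols that lead to the same state, as all
    of them do when \<open>m = 0\<close>.\<close>
  define T where "T = (\<lambda>(a, b) (s, \<kappa>, \<rho>) q. \<Sum>r\<in>symbols (D s).
      of_bool (local_map (D s) m (\<kappa> @ [a]) (\<rho> @ [r]) = b) / real (card (symbols (D s))) *
      of_bool (q = (s, tl (\<kappa> @ [a]), tl (\<rho> @ [r]))))"
  have D: "nbh_bounded (D s) m" "finite (symbols (D s))" for s
    using bounded fin by (auto simp: D_def)
  have finS: "finite S"
    unfolding S_def using D fin by (intro finite_SigmaI finite_cartesian_product finite_words) auto
  have cardS: "card S = card Q ^ (2 * m) * (card (symbols A) ^ (2 * m) + card (symbols B) ^ (2 * m))"
    unfolding S_def using D fin
    by (subst card_SigmaI)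
      (auto simp: UNIV_bool card_cartesian_product card_words finite_words D_def algebra_simps)
  have val: "wa_value S T x (s, \<kappa>, \<rho>) = ext_prob (D s) m x \<kappa> \<rho>"
    if "set x \<subseteq> Q \<times> Q" "(s, \<kappa>, \<rho>) \<in> S" for x s \<kappa> \<rho>
    using that
  proof (induction x arbitrary: \<kappa> \<rho>)
    case Nil
    then show ?case by (simp add: ext_prob_Nil)
  next
    case (Cons l x)
    obtain a b where l: "l = (a, b)" by (cases l)
    have a: "a \<in> Q" using Cons.prems l by auto
    let ?next = "\<lambda>r. (s, tl (\<kappa> @ [a]), tl (\<rho> @ [r]))"
    let ?c = "\<lambda>r. of_bool (local_map (D s) m (\<kappa> @ [a]) (\<rho> @ [r]) = b) / real (card (symbols (D s)))"
    have len: "length \<kappa> = 2 * m" "length \<rho> = 2 * m" "set \<kappa> \<subseteq> Q" "set \<rho> \<subseteq> symbols (D s)"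
      using Cons.prems(2) by (auto simp: S_def words_def)
    have tl_subset: "set (tl (y @ [c])) \<subseteq> insert c (set y)" for y :: "nat list" and c
      by (cases y) auto
    have "?next r \<in> S" if "r \<in> symbols (D s)" for r
      using len a that tl_subset[of \<kappa> a] tl_subset[of \<rho> r] by (auto simp: S_def words_def)
    then have step: "?next r \<in> S \<and> wa_value S T x (?next r) = ext_prob (D s) m x (tl (\<kappa> @ [a])) (tl (\<rho> @ [r]))"
      if "r \<in> symbols (D s)" for r
      using Cons.IH Cons.prems(1) that by simp
    have "wa_value S T (l # x) (s, \<kappa>, \<rho>) =
        (\<Sum>q\<in>S. \<Sum>r\<in>symbols (D s). ?c r * of_bool (q = ?next r) * wa_value S T x q)"
      using Cons.prems(2) by (simp add: l T_def sum_distrib_right)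
    also have "\<dots> = (\<Sum>r\<in>symbols (D s). \<Sum>q\<in>S. if q = ?next r then ?c r * wa_value S T x q else 0)"
      by (subst sum.swap) (intro sum.cong refl, simp)
    also have "\<dots> = (\<Sum>r\<in>symbols (D s). ?c r * ext_prob (D s) m x (tl (\<kappa> @ [a])) (tl (\<rho> @ [r])))"
    proof (intro sum.cong refl)
      fix r assume "r \<in> symbols (D s)"
      from step[OF this] show "(\<Sum>q\<in>S. if q = ?next r then ?c r * wa_value S T x q else 0) =
          ?c r * ext_prob (D s) m x (tl (\<kappa> @ [a])) (tl (\<rho> @ [r]))"
        using finS by (simp add: sum.delta)
    qed
    also have "\<dots> = ext_prob (D s) m (l # x) \<kappa> \<rho>"
      unfolding l using ext_prob_Cons[OF D len(1,2), where a = a and b = b and x = x] by simp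
    finally show ?case .
  qed
  \<comment> \<open>Initial weights: concentrated on the context \<open>\<kappa>\<close>, uniform
    over the first \<open>2m\<close> symbols, with a sign that subtracts \<open>B\<close> from
    \<open>A\<close>.\<close>
  define \<alpha> where "\<alpha> \<kappa> = (\<lambda>(s, \<kappa>', \<rho> :: nat list). of_bool (\<kappa>' = \<kappa>) *
      ((if s then 1 else -1) / real (card (symbols (D s)) ^ (2 * m))))" for \<kappa> :: "nat list"
  have functional: "(\<Sum>q\<in>S. \<alpha> \<kappa> q * wa_value S T x q) =
      word_prob A m (\<kappa> @ map fst x) (map snd x) - word_prob B m (\<kappa> @ map fst x) (map snd x)"
    if x: "set x \<subseteq> Q \<times> Q" and \<kappa>: "\<kappa> \<in> words Q (2 * m)" for x \<kappa>
  proof -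
    have "(\<Sum>q\<in>S. \<alpha> \<kappa> q * wa_value S T x q) =
        (\<Sum>(s, \<kappa>', \<rho>)\<in>S. \<alpha> \<kappa> (s, \<kappa>', \<rho>) * ext_prob (D s) m x \<kappa>' \<rho>)"
      using val[OF x] by (intro sum.cong) auto
    also have "\<dots> = (\<Sum>s\<in>UNIV. \<Sum>(\<kappa>', \<rho>)\<in>words Q (2 * m) \<times> words (symbols (D s)) (2 * m).
        \<alpha> \<kappa> (s, \<kappa>', \<rho>) * ext_prob (D s) m x \<kappa>' \<rho>)"
      unfolding S_def using D fin by (subst sum.Sigma) (auto simp: finite_words)
    also have "\<dots> = (\<Sum>s\<in>UNIV. (if s then 1 else -1) * word_prob (D s) m (\<kappa> @ map fst x) (map snd x))"
    proof (intro sum.cong refl)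
      fix s
      let ?k = "(if s then 1 else -1) / real (card (symbols (D s)) ^ (2 * m))"
      have "(\<Sum>(\<kappa>', \<rho>)\<in>words Q (2 * m) \<times> words (symbols (D s)) (2 * m). \<alpha> \<kappa> (s, \<kappa>', \<rho>) * ext_prob (D s) m x \<kappa>' \<rho>)
        = (\<Sum>\<kappa>'\<in>words Q (2 * m). if \<kappa>' = \<kappa> then \<Sum>\<rho>\<in>words (symbols (D s)) (2 * m). ?k * ext_prob (D s) m x \<kappa>' \<rho> else 0)"
        unfolding sum.cartesian_product[symmetric] by (intro sum.cong refl) (simp add: \<alpha>_def)
      also have "\<dots> = ?k * (\<Sum>\<rho>\<in>words (symbols (D s)) (2 * m). ext_prob (D s) m x \<kappa> \<rho>)"
        using \<kappa> finite_words[OF fin(1), of "2 * m"] by (simp add: sum.delta sum_distrib_left)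
      finally show "(\<Sum>(\<kappa>', \<rho>)\<in>words Q (2 * m) \<times> words (symbols (D s)) (2 * m). \<alpha> \<kappa> (s, \<kappa>', \<rho>) * ext_prob (D s) m x \<kappa>' \<rho>)
        = (if s then 1 else -1) * word_prob (D s) m (\<kappa> @ map fst x) (map snd x)"
        using word_prob_eq_ext_prob[OF D(2), where m = m and \<kappa> = \<kappa> and x = x] by simp
    qed
    finally show ?thesis by (simp add: UNIV_bool D_def)
  qed
  \<comment> \<open>The first \<open>2m\<close> states of \<open>u\<close> select the functional;
    the other \<open>n\<close> are paired with the letters of \<open>w\<close>.\<close>
  define \<kappa> where "\<kappa> = take (2 * m) u"
  define x where "x = zip (drop (2 * m) u) w"
  have len: "length u = n + 2 * m" "length w = n" "set u \<subseteq> Q" "set w \<subseteq> Q"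
    using u w by (auto simp: words_def)
  have \<kappa>: "\<kappa> \<in> words Q (2 * m)"
    using len by (auto simp: \<kappa>_def words_def dest: in_set_takeD)
  have x: "set x \<subseteq> Q \<times> Q"
    using len(3,4) by (auto simp: x_def elim!: in_set_zipE dest!: in_set_dropD)
  have uw: "\<kappa> @ map fst x = u" "map snd x = w"
    using len by (simp_all add: \<kappa>_def x_def)
  have "(\<Sum>q\<in>S. \<alpha> \<kappa> q * wa_value S T x q) = 0"
  proof (rule wa_equivalence_bound[OF finS _ x])
    fix y assume y: "set y \<subseteq> Q \<times> Q" "length y \<le> card S"
    have "\<kappa> @ map fst y \<in> words Q (length y + 2 * m)" "map snd y \<in> words Q (length y)"
      using y \<kappa> by (auto simp: words_def)
    then show "(\<Sum>q\<in>S. \<alpha> \<kappa> q * wa_value S T y q) = 0"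
      using short[of "length y"] y unfolding functional[OF y(1) \<kappa>] cardS by simp
  qed
  then show ?thesis unfolding functional[OF x \<kappa>] uw by simp
qed

section \<open>Cylinder events and the laws given by the global functions\<close>

definition window :: "int \<Rightarrow> nat \<Rightarrow> (int \<Rightarrow> nat) \<Rightarrow> nat list" where
  "window z n d = map (\<lambda>i. d (z + int i)) [0..<n]"

lemma length_window [simp]: "length (window z n d) = n"
  by (simp add: window_def)

lemma nth_window: "i < n \<Longrightarrow> window z n d ! i = d (z + int i)"
  by (simp add: window_def)

lemma nth_window_shift: "z \<le> j \<Longrightarrow> j < z + int n \<Longrightarrow> window z n d ! nat (j - z) = d j"
  by (subst nth_window) auto

lemma window_in_words: "d \<in> UNIV \<rightarrow> S \<Longrightarrow> window z n d \<in> words S n"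
  by (auto simp: window_def words_def)

lemma cylinder_eq_prod_emb:
  assumes "length w = n" "set w \<subseteq> S" "space M = UNIV \<rightarrow> S"
  shows "{d \<in> space M. window z n d = w} = prod_emb UNIV (\<lambda>_. count_space S) {z..<z + int n}
    (\<Pi>\<^sub>E j\<in>{z..<z + int n}. {w ! nat (j - z)})"
proof -
  have "window z n d = w \<longleftrightarrow> (\<forall>j\<in>{z..<z + int n}. d j = w ! nat (j - z))" for d
  proof
    assume *: "window z n d = w"
    show "\<forall>j\<in>{z..<z + int n}. d j = w ! nat (j - z)"
      using nth_window_shift[of z _ n d] * by auto
  next
    assume *: "\<forall>j\<in>{z..<z + int n}. d j = w ! nat (j - z)"
    then show "window z n d = w"
      using assms(1) by (intro nth_equalityI) (auto simp: nth_window)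
  qed
  then show ?thesis
    using assms(3) by (auto simp: prod_emb_def PiE_iff extensional_def)
qed

lemma sets_cylinder:
  assumes M: "sets M = sets (\<Pi>\<^sub>M z\<in>UNIV. count_space S)" and w: "w \<in> words S n"
  shows "{d \<in> space M. window z n d = w} \<in> sets M"
proof -
  have "space M = UNIV \<rightarrow> S"
    using sets_eq_imp_space_eq[OF M] by (simp add: space_PiM PiE_def)
  then show ?thesis
    using w unfolding M
    by (subst cylinder_eq_prod_emb[of w n S]) (auto simp: words_def intro!: sets_PiM_I subsetD[OF _ nth_mem, of w S])
qed

text \<open>An event that depends on a finite window is a disjoint union of finitely many cylinders,
  one for each admissible word.\<close>

lemma measure_window:
  assumes "finite_measure M" and M: "sets M = sets (\<Pi>\<^sub>M z\<in>UNIV. count_space S)" and S: "finite S"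
  shows "{d \<in> space M. P (window z n d)} \<in> sets M" (is "?E \<in> _")
    and "measure M {d \<in> space M. P (window z n d)} =
      (\<Sum>w\<in>{w \<in> words S n. P w}. measure M {d \<in> space M. window z n d = w})"
proof -
  interpret finite_measure M by fact
  let ?W = "{w \<in> words S n. P w}"
  have spM: "space M = UNIV \<rightarrow> S"
    using sets_eq_imp_space_eq[OF M] by (simp add: space_PiM PiE_def)
  have eq: "?E = (\<Union>w\<in>?W. {d \<in> space M. window z n d = w})"
    using window_in_words[of _ S z n] by (auto simp: spM)
  have fin: "finite ?W" using finite_words[OF S] by simp
  have meas: "{d \<in> space M. window z n d = w} \<in> sets M" if "w \<in> ?W" for w
    using that by (intro sets_cylinder[OF M]) auto
  show "?E \<in> sets M" unfolding eq using fin meas by blast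
  show "measure M ?E = (\<Sum>w\<in>?W. measure M {d \<in> space M. window z n d = w})"
    unfolding eq
    by (intro finite_measure_finite_Union fin) (use meas in \<open>auto simp: disjoint_family_on_def\<close>)
qed

lemma sets_symbol_measure:
  "sets (symbol_measure A) = sets (\<Pi>\<^sub>M z\<in>UNIV. count_space (symbols A))"
  unfolding symbol_measure_def by (intro sets_PiM_cong refl) (simp add: sets_uniform_count_measure)

lemma prob_space_symbol_measure: "stochastic_CA A \<Longrightarrow> prob_space (symbol_measure A)"
  unfolding symbol_measure_def
  by (intro prob_space_PiM prob_space_uniform_count_measure) (auto simp: stochastic_CA_def)

lemma measure_symbol_cylinder:
  assumes A: "stochastic_CA A" and t: "t \<in> words (symbols A) n"
  shows "measure (symbol_measure A) {s \<in> space (symbol_measure A). window z n s = t} =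
    1 / card (symbols A) ^ n"
proof -
  let ?R = "symbols A" and ?J = "{z..<z + int n}"
  have R: "finite ?R" "?R \<noteq> {}" using A by (auto simp: stochastic_CA_def)
  have t': "length t = n" "set t \<subseteq> ?R" using t by (auto simp: words_def)
  have sp: "space (symbol_measure A) = UNIV \<rightarrow> ?R"
    by (simp add: symbol_measure_def space_PiM space_uniform_count_measure PiE_def)
  have letter: "{t ! nat (j - z)} \<subseteq> ?R" if "j \<in> ?J" for j
    using that t' nth_mem[of "nat (j - z)" t] by auto
  have "emeasure (symbol_measure A) {s \<in> space (symbol_measure A). window z n s = t} =
      emeasure (symbol_measure A) (prod_emb UNIV (\<lambda>_. uniform_count_measure ?R) ?J (\<Pi>\<^sub>E j\<in>?J. {t ! nat (j - z)}))"
    unfolding cylinder_eq_prod_emb[OF t' sp] by (simp add: prod_emb_def space_uniform_count_measure)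
  also have "\<dots> = (\<Prod>j\<in>?J. emeasure (uniform_count_measure ?R) {t ! nat (j - z)})"
    unfolding symbol_measure_def using R letter
    by (intro emeasure_PiM_emb prob_space_uniform_count_measure)
      (auto simp: sets_uniform_count_measure)
  also have "\<dots> = (\<Prod>j\<in>?J. ennreal (1 / card ?R))"
    using letter R by (intro prod.cong refl) (simp add: emeasure_uniform_count_measure)
  also have "\<dots> = ennreal ((1 / card ?R) ^ n)"
    by (simp add: ennreal_power)
  finally show ?thesis by (simp add: measure_def power_one_over)
qed

lemma local_map_window:
  assumes "nbh_bounded A m" "i < n"
  shows "local_map A m (drop i (window (z - int m) (n + 2 * m) c)) (drop i (window (z - int m) (n + 2 * m) s)) =
    explicit_global A c s (z + int i)"
proof -
  have "drop i (window (z - int m) (n + 2 * m) d) ! nat (int m + v) = d (z + int i + v)"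
    if "v \<in> set (nbh A) \<union> set (symbol_nbh A)" for v d
  proof -
    have "\<bar>v\<bar> \<le> int m" using that assms(1) by (auto simp: nbh_bounded_def)
    then have "i + nat (int m + v) < n + 2 * m" "z - int m + int (i + nat (int m + v)) = z + int i + v"
      using assms(2) by linarith+
    then show ?thesis using nth_window[of "i + nat (int m + v)" "n + 2 * m" "z - int m" d]
      by (simp only: nth_drop length_window)
  qed
  then show ?thesis
    by (auto simp: local_map_def explicit_global_def intro!: arg_cong2[of _ _ _ _ "rule A"])
qed

lemma emits_window:
  assumes "nbh_bounded A m" "length w = n"
  shows "emits A m (window (z - int m) (n + 2 * m) c) (window (z - int m) (n + 2 * m) s) w \<longleftrightarrow>
    window z n (explicit_global A c s) = w"
  using assms local_map_window[OF assms(1), of _ n z c s]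
  by (auto simp: emits_def list_eq_iff_nth_eq nth_window)

text \<open>The preimage of a cylinder depends on \<open>n + 2m\<close> random symbols only, and
  these are uniform. The position \<open>z\<close> enters the result only through the content of the
  window of \<open>c\<close>: this is the translation invariance.\<close>

lemma measure_stochastic_global:
  assumes A: "stochastic_CA A" "nbh_bounded A m" and M: "stochastic_global A c = Some M"
    and w: "w \<in> words (states A) n"
  shows "measure M {d \<in> space M. window z n d = w} =
    word_prob A m (window (z - int m) (n + 2 * m) c) w"
proof -
  let ?S = "symbol_measure A" and ?u = "window (z - int m) (n + 2 * m) c"
  have c: "c \<in> UNIV \<rightarrow> states A" and M': "M = distr ?S (config_space A) (explicit_global A c)"
    using M by (auto simp: stochastic_global_def split: if_splits)
  interpret S: prob_space ?S by (rule prob_space_symbol_measure[OF A(1)])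
  have fin: "finite (symbols A)" using A by (simp add: stochastic_CA_def)
  have len: "length w = n" using w by (simp add: words_def)
  have "measure M {d \<in> space M. window z n d = w} =
      measure ?S (explicit_global A c -` {d \<in> space M. window z n d = w} \<inter> space ?S)"
    unfolding M' by (intro measure_distr measurable_explicit_global A(1) c)
      (use w in \<open>auto simp: config_space_def intro!: sets_cylinder[of _ "states A"]\<close>)
  also have "explicit_global A c -` {d \<in> space M. window z n d = w} \<inter> space ?S =
      {s \<in> space ?S. emits A m ?u (window (z - int m) (n + 2 * m) s) w}"
    using measurable_space[OF measurable_explicit_global[OF A(1) c]]
    by (auto simp: M' emits_window[OF A(2) len])
  also have "measure ?S \<dots> = (\<Sum>t\<in>{t \<in> words (symbols A) (n + 2 * m). emits A m ?u t w}.
      1 / card (symbols A) ^ (n + 2 * m))"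
    by (subst measure_window(2)[OF S.finite_measure_axioms sets_symbol_measure fin,
          where P = "\<lambda>t. emits A m ?u t w"])
      (simp add: measure_symbol_cylinder[OF A(1)])
  finally show ?thesis by (simp add: word_prob_def len)
qed

text \<open>In one direction, each \<open>u\<close> occurs as the window of some configuration. In
  the other, a measure on the product is determined by boxes with finitely many constrained
  coordinates, and such a box depends on a finite window.\<close>

lemma stochastic_global_eq_iff:
  assumes A: "stochastic_CA A" "nbh_bounded A m" and B: "stochastic_CA B" "nbh_bounded B m"
    and m: "0 < m"
  shows "stochastic_global A = stochastic_global B \<longleftrightarrow> states A = states B \<and>
    (\<forall>n. \<forall>u\<in>words (states A) (n + 2 * m). \<forall>w\<in>words (states A) n. word_prob A m u w = word_prob B m u w)"
proof (intro iffI conjI allI ballI; (elim conjE)?)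
  assume eq: "stochastic_global A = stochastic_global B"
  \<comment> \<open>Constant configurations recover the set of states from the domain of the partial
    map.\<close>
  have dom: "stochastic_global D (\<lambda>_. q) \<noteq> None \<longleftrightarrow> q \<in> states D" for D q
    by (auto simp: stochastic_global_def)
  show states: "states A = states B"
    using eq dom[of A] dom[of B] by auto
  fix n u w assume u: "u \<in> words (states A) (n + 2 * m)" and w: "w \<in> words (states A) n"
  \<comment> \<open>Outside the window the configuration is filled with \<open>u ! 0\<close>; since
    \<open>0 < m\<close>, the word \<open>u\<close> is nonempty even for
    \<open>n = 0\<close>.\<close>
  define c where "c z = (if 0 \<le> z + int m \<and> z + int m < int (length u) then u ! nat (z + int m) else u ! 0)" for z
  have len: "length u = n + 2 * m" "set u \<subseteq> states A" using u by (auto simp: words_def)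
  have c: "c \<in> UNIV \<rightarrow> states A"
    using len m nth_mem[of _ u] by (auto simp: c_def intro!: subsetD[OF len(2)] nth_mem)
  have win: "window (0 - int m) (n + 2 * m) c = u"
    using len by (intro nth_equalityI) (auto simp: nth_window c_def)
  obtain M where M: "stochastic_global A c = Some M" using c by (auto simp: stochastic_global_def)
  have "stochastic_global B c = Some M" using M eq by simp
  then show "word_prob A m u w = word_prob B m u w"
    using measure_stochastic_global[OF A M w, of 0] measure_stochastic_global[OF B, of c M w n 0] w states win
    by simp
next
  assume states: "states A = states B"
    and eq: "\<forall>n. \<forall>u\<in>words (states A) (n + 2 * m). \<forall>w\<in>words (states A) n. word_prob A m u w = word_prob B m u w"
  let ?Q = "states A"
  have fin: "finite ?Q" using A by (simp add: stochastic_CA_def)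
  show "stochastic_global A = stochastic_global B"
  proof
    fix c
    show "stochastic_global A c = stochastic_global B c"
    proof (cases "c \<in> UNIV \<rightarrow> ?Q")
      case True
      then obtain M N where M: "stochastic_global A c = Some M" and N: "stochastic_global B c = Some N"
        using states by (auto simp: stochastic_global_def)
      interpret M: prob_space M by (rule prob_space_stochastic_global[OF A(1) M])
      interpret N: prob_space N by (rule prob_space_stochastic_global[OF B(1) N])
      have sets: "sets M = sets (\<Pi>\<^sub>M z\<in>UNIV. count_space ?Q)" "sets N = sets (\<Pi>\<^sub>M z\<in>UNIV. count_space ?Q)"
        using M N states by (auto simp: stochastic_global_def config_space_def split: if_splits)
      have space: "space M = UNIV \<rightarrow> ?Q" "space N = UNIV \<rightarrow> ?Q"
        using prob_space_stochastic_global(2)[OF A(1) M] prob_space_stochastic_global(2)[OF B(1) N] states by auto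
      have "M = N"
      proof (rule measure_eqI_PiM_infinite[OF sets])
        fix X J assume J: "finite J" "J \<subseteq> (UNIV :: int set)" and X: "\<And>i. i \<in> J \<Longrightarrow> X i \<in> sets (count_space ?Q)"
        \<comment> \<open>The interval spans \<open>J\<close> together with 0; inserting 0 keeps
          \<open>Min\<close> and \<open>Max\<close> meaningful when \<open>J\<close> is
          empty.\<close>
        define z where "z = Min (insert 0 J)"
        define n where "n = nat (Max (insert 0 J) - z + 1)"
        have J_range: "z \<le> j \<and> j < z + int n" if "j \<in> J" for j
        proof -
          have "z \<le> j" "j \<le> Max (insert 0 J)" using J that by (auto simp: z_def)
          then show ?thesis by (simp add: n_def)
        qed
        define P where "P = (\<lambda>w :: nat list. \<forall>j\<in>J. w ! nat (j - z) \<in> X j)"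
        have "P (window z n d) \<longleftrightarrow> (\<forall>j\<in>J. d j \<in> X j)" for d
          unfolding P_def using J_range by (intro ball_cong refl) (simp add: nth_window_shift)
        then have emb: "prod_emb UNIV (\<lambda>_. count_space ?Q) J (Pi\<^sub>E J X) = {d \<in> UNIV \<rightarrow> ?Q. P (window z n d)}"
          by (auto simp: prod_emb_def PiE_iff)
        have "measure M {d \<in> space M. P (window z n d)} = measure N {d \<in> space N. P (window z n d)}"
          unfolding measure_window(2)[OF M.finite_measure_axioms sets(1) fin] measure_window(2)[OF N.finite_measure_axioms sets(2) fin]
        proof (intro sum.cong refl)
          fix w assume "w \<in> {w \<in> words ?Q n. P w}"
          then have w: "w \<in> words ?Q n" by simp
          show "measure M {d \<in> space M. window z n d = w} = measure N {d \<in> space N. window z n d = w}"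
            using measure_stochastic_global[OF A M w, of z] measure_stochastic_global[OF B N, of w n z]
              w states eq[rule_format, OF window_in_words[OF True] w, of "z - int m"] by simp
        qed
        then show "emeasure M (prod_emb UNIV (\<lambda>_. count_space ?Q) J (Pi\<^sub>E J X)) =
            emeasure N (prod_emb UNIV (\<lambda>_. count_space ?Q) J (Pi\<^sub>E J X))"
          unfolding emb M.emeasure_eq_measure N.emeasure_eq_measure space by simp
      qed (rule M.finite_measure_axioms)
      then show ?thesis using M N by simp
    next
      case False
      then show ?thesis using states by (auto simp: stochastic_global_def)
    qed
  qed
qed

section \<open>The decision procedure\<close>

lemma ex_code_nth_list_encode:
  "(\<exists>j<list_encode xs. code_drop j (list_encode xs) \<noteq> 0 \<and> P (code_nth (list_encode xs) j)) \<longleftrightarrow>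
    (\<exists>y\<in>set xs. P y)"
proof -
  have "(\<exists>j<list_encode xs. j < length xs \<and> P (code_nth (list_encode xs) j)) \<longleftrightarrow>
      (\<exists>j<length xs. P (code_nth (list_encode xs) j))"
    using length_le_list_encode[of xs] by (auto intro: less_le_trans)
  also have "\<dots> \<longleftrightarrow> (\<exists>j<length xs. P (xs ! j))"
    using code_nth_list_encode[of _ xs] by auto
  also have "\<dots> \<longleftrightarrow> (\<exists>y\<in>set xs. P y)"
    by (metis in_set_conv_nth)
  finally show ?thesis unfolding code_drop_eq_0 not_le .
qed

text \<open>Adds an encoded integer to a position without integer arithmetic:
  \<open>int_encode\<close> sends \<open>v >= 0\<close> to \<open>2v\<close> and
  \<open>v < 0\<close> to \<open>-2v - 1\<close>, so parity gives the sign. Truncated subtraction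
  agrees with \<open>nat\<close>.\<close>

definition offset :: "nat \<Rightarrow> nat \<Rightarrow> nat" where
  "offset p c = (if c mod 2 = 0 then p + c div 2 else p - Suc (c div 2))"

lemma offset_int_encode: "offset p (int_encode v) = nat (int p + v)"
  by (auto simp: offset_def int_encode_def sum_encode_def nat_diff_distrib')

lemma abs_le_int_encode: "\<bar>v\<bar> \<le> int (int_encode v)"
  by (auto simp: int_encode_def sum_encode_def)

lemma recursive_offset: "recursive k a \<Longrightarrow> recursive k b \<Longrightarrow> recursive k (\<lambda>e. offset (a e) (b e))"
  unfolding offset_def by (intro recursive_div recursive_mod recursive_intros)

text \<open>The argument list of the local rule is not constructed; a candidate code
  \<open>l\<close> is compared entry by entry with the digits found at the shifted positions. The
  number of comparisons is the length of the list coded by \<open>V\<close>, so \<open>l\<close> is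
  meant to have the same length.\<close>

definition reads :: "nat \<Rightarrow> nat \<Rightarrow> nat \<Rightarrow> nat \<Rightarrow> nat \<Rightarrow> bool" where
  "reads b l V p x \<longleftrightarrow>
    (\<forall>j<V. code_drop j V \<noteq> 0 \<longrightarrow> code_nth l j = digit b x (offset p (code_nth V j)))"

lemma rec_pred_reads:
  assumes "recursive k a" "recursive k b" "recursive k c" "recursive k d" "recursive k g"
  shows "rec_pred k (\<lambda>e. reads (a e) (b e) (c e) (d e) (g e))"
proof (rule recursive_compose5[OF _ assms])
  show "rec_pred 5 (\<lambda>e. reads (e 0) (e 1) (e 2) (e 3) (e 4))"
    unfolding reads_def
    by (intro recursive_digit recursive_offset recursive_code_drop recursive_code_nth recursive_intros; simp)
qed

lemma reads_list_encode:
  assumes "length l = length vs"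
  shows "reads b (list_encode l) (list_encode (map int_encode vs)) p x \<longleftrightarrow>
    l = map (\<lambda>v. digit b x (nat (int p + v))) vs"
proof -
  let ?V = "list_encode (map int_encode vs)"
  have "reads b (list_encode l) ?V p x \<longleftrightarrow>
      (\<forall>j<length vs. code_nth (list_encode l) j = digit b x (offset p (code_nth ?V j)))"
    unfolding reads_def code_drop_eq_0 not_le
    using length_le_list_encode[of "map int_encode vs"] by (auto intro: less_le_trans)
  then show ?thesis
    using assms by (simp add: code_nth_list_encode offset_int_encode list_eq_iff_nth_eq)
qed

text \<open>The local rule is applied by searching its table, field 4 of the description, for an
  entry with the right arguments and value. The radius is \<open>b\<close> itself, hence output cell
  \<open>i\<close> lies over input position \<open>b + i\<close>.\<close>

definition step_ok :: "nat \<Rightarrow> nat \<Rightarrow> nat \<Rightarrow> nat \<Rightarrow> nat \<Rightarrow> nat \<Rightarrow> bool" where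
  "step_ok a b x y w i \<longleftrightarrow> (\<exists>j<code_nth a 4. code_drop j (code_nth a 4) \<noteq> 0 \<and>
     reads b (code_nth (code_nth (code_nth a 4) j) 0) (code_nth a 2) (b + i) x \<and>
     reads b (code_nth (code_nth (code_nth a 4) j) 1) (code_nth a 3) (b + i) y \<and>
     code_nth (code_nth (code_nth a 4) j) 2 = digit b w i)"

definition count_code :: "nat \<Rightarrow> nat \<Rightarrow> nat \<Rightarrow> nat \<Rightarrow> nat \<Rightarrow> nat" where
  "count_code a b n x w = (\<Sum>y<b ^ (n + 2 * b).
     if (\<forall>i<n + 2 * b. code_member (digit b y i) (code_nth a 1)) \<and> (\<forall>i<n. step_ok a b x y w i)
     then 1 else 0)"

definition symbol_count_code :: "nat \<Rightarrow> nat \<Rightarrow> nat" where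
  "symbol_count_code a b = (\<Sum>y<b. if code_member y (code_nth a 1) then 1 else 0)"

text \<open>
  The number \<open>Suc (a + a')\<close> exceeds all states, symbols and radii of both automata, hence it serves
  both as the base of the digits that represent words and as the radius \<open>m\<close>.
\<close>

definition equal_code :: "nat \<Rightarrow> nat \<Rightarrow> bool" where
  "equal_code a a' \<longleftrightarrow> code_nth a 0 = code_nth a' 0 \<and>
    (\<forall>n<Suc (Suc (a + a') ^ (2 * Suc (a + a')) * (2 * Suc (a + a') ^ (2 * Suc (a + a')))).
     \<forall>x<Suc (a + a') ^ (n + 2 * Suc (a + a')). \<forall>w<Suc (a + a') ^ n.
      (\<forall>i<n + 2 * Suc (a + a'). code_member (digit (Suc (a + a')) x i) (code_nth a 0)) \<and>
      (\<forall>i<n. code_member (digit (Suc (a + a')) w i) (code_nth a 0)) \<longrightarrow>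
      count_code a (Suc (a + a')) n x w * symbol_count_code a' (Suc (a + a')) ^ (n + 2 * Suc (a + a')) =
      count_code a' (Suc (a + a')) n x w * symbol_count_code a (Suc (a + a')) ^ (n + 2 * Suc (a + a')))"

lemma recursive_symbol_count_code:
  assumes "recursive k a" "recursive k b" shows "recursive k (\<lambda>e. symbol_count_code (a e) (b e))"
proof (rule recursive_compose2[OF _ assms])
  show "recursive 2 (\<lambda>e. symbol_count_code (e 0) (e 1))"
    unfolding symbol_count_code_def
    by (intro rec_pred_code_member recursive_code_nth recursive_intros; simp)
qed

lemma recursive_count_code:
  assumes "recursive k a" "recursive k b" "recursive k c" "recursive k d" "recursive k g"
  shows "recursive k (\<lambda>e. count_code (a e) (b e) (c e) (d e) (g e))"
proof (rule recursive_compose5[OF _ assms])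
  show "recursive 5 (\<lambda>e. count_code (e 0) (e 1) (e 2) (e 3) (e 4))"
    unfolding count_code_def step_ok_def
    by (intro rec_pred_reads rec_pred_code_member recursive_digit recursive_code_drop
        recursive_code_nth recursive_intros; simp)
qed

lemma rec_pred_equal_code: "rec_pred 2 (\<lambda>e. equal_code (e 0) (e 1))"
  unfolding equal_code_def
  by (intro recursive_count_code recursive_symbol_count_code rec_pred_code_member recursive_digit
      recursive_code_nth recursive_intros; simp)

section \<open>Correctness of the test on encoded automata\<close>

lemma code_nth_sca_encode:
  "code_nth (sca_encode A) 0 = list_encode (sorted_list_of_set (states A))"
  "code_nth (sca_encode A) 1 = list_encode (sorted_list_of_set (symbols A))"
  "code_nth (sca_encode A) 2 = list_encode (map int_encode (nbh A))"
  "code_nth (sca_encode A) 3 = list_encode (map int_encode (symbol_nbh A))"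
  "code_nth (sca_encode A) 4 = list_encode (rule_table A)"
  unfolding sca_encode_def by (subst code_nth_list_encode; simp)+

lemma code_member_sca_encode:
  assumes "stochastic_CA A"
  shows "code_member q (code_nth (sca_encode A) 0) \<longleftrightarrow> q \<in> states A"
    and "code_member q (code_nth (sca_encode A) 1) \<longleftrightarrow> q \<in> symbols A"
  using assms by (simp_all only: code_nth_sca_encode code_member_list_encode)
    (simp_all add: stochastic_CA_def)

text \<open>An entry is smaller than the code of its list, applied at both levels of nesting; the
  absolute value of an integer is at most its code.\<close>

lemma sca_encode_bounds:
  assumes A: "stochastic_CA A" and b: "sca_encode A < b"
  shows "states A \<subseteq> {..<b}" "symbols A \<subseteq> {..<b}" "nbh_bounded A b"
proof -
  have fin: "finite (states A)" "finite (symbols A)" using A by (auto simp: stochastic_CA_def)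
  have less: "c < b" if "c \<in> set l" "list_encode l \<in> set
      [list_encode (sorted_list_of_set (states A)),
      list_encode (sorted_list_of_set (symbols A)),
      list_encode (map int_encode (nbh A)),
      list_encode (map int_encode (symbol_nbh A)),
      list_encode (rule_table A)]" for c l
  proof -
    have "c < list_encode l" "list_encode l < sca_encode A"
      using member_less_list_encode[OF that(1)] member_less_list_encode[OF that(2)]
      unfolding sca_encode_def by auto
    then show ?thesis using b by simp
  qed
  show "states A \<subseteq> {..<b}"
    using less[of _ "sorted_list_of_set (states A)"] fin by auto
  show "symbols A \<subseteq> {..<b}"
    using less[of _ "sorted_list_of_set (symbols A)"] fin by auto
  have "\<bar>v\<bar> \<le> int b" if "v \<in> set (nbh A) \<union> set (symbol_nbh A)" for v
  proof -
    have "int_encode v < b"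
      using that less[of "int_encode v" "map int_encode (nbh A)"]
        less[of "int_encode v" "map int_encode (symbol_nbh A)"] by auto
    then show ?thesis using abs_le_int_encode[of v] by linarith
  qed
  then show "nbh_bounded A b" by (auto simp: nbh_bounded_def)
qed

text \<open>As the digits of \<open>x\<close> and \<open>y\<close> are states and symbols, the
  arguments read at cell \<open>i\<close> occur in the table. The search therefore meets their
  entry, and \<open>reads\<close> excludes entries with other arguments.\<close>

lemma step_ok_sca_encode:
  assumes A: "stochastic_CA A" "nbh_bounded A b" and i: "i < n"
    and x: "digits b (n + 2 * b) x \<in> words (states A) (n + 2 * b)"
    and y: "digits b (n + 2 * b) y \<in> words (symbols A) (n + 2 * b)"
  shows "step_ok (sca_encode A) b x y w i \<longleftrightarrow>
    local_map A b (drop i (digits b (n + 2 * b) x)) (drop i (digits b (n + 2 * b) y)) = digit b w i"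
proof -
  let ?qs = "map (\<lambda>v. digit b x (nat (int (b + i) + v))) (nbh A)"
  let ?rs = "map (\<lambda>v. digit b y (nat (int (b + i) + v))) (symbol_nbh A)"
  have pos: "nat (int (b + i) + v) < n + 2 * b \<and> i + nat (int b + v) = nat (int (b + i) + v)"
    if "v \<in> set (nbh A) \<union> set (symbol_nbh A)" for v
  proof -
    have "\<bar>v\<bar> \<le> int b" using that A(2) by (auto simp: nbh_bounded_def)
    then show ?thesis using i by (auto simp: nat_add_distrib)
  qed
  have drop_digits: "drop i (digits b (n + 2 * b) z) ! nat (int b + v) = digit b z (nat (int (b + i) + v))"
    if "v \<in> set (nbh A) \<union> set (symbol_nbh A)" for v z
  proof -
    have "drop i (digits b (n + 2 * b) z) ! nat (int b + v) = digits b (n + 2 * b) z ! nat (int (b + i) + v)"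
      using pos[OF that] i by (subst nth_drop) (auto simp: digits_def)
    also have "\<dots> = digit b z (nat (int (b + i) + v))"
      using pos[OF that] by (simp add: digits_def)
    finally show ?thesis .
  qed
  have loc: "local_map A b (drop i (digits b (n + 2 * b) x)) (drop i (digits b (n + 2 * b) y)) = rule A ?qs ?rs"
    unfolding local_map_def using drop_digits
    by (intro arg_cong2[of _ _ _ _ "rule A"] map_cong refl) auto
  have fin: "finite (states A)" "finite (symbols A)" using A by (auto simp: stochastic_CA_def)
  have "set ?qs \<subseteq> states A" "set ?rs \<subseteq> symbols A"
    using pos x y by (auto simp: digits_in_words)
  then have mem: "?qs \<in> set (List.n_lists (length (nbh A)) (sorted_list_of_set (states A)))"
    "?rs \<in> set (List.n_lists (length (symbol_nbh A)) (sorted_list_of_set (symbols A)))"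
    using fin by (auto simp: set_n_lists)
  have entry: "code_nth (list_encode [p, q, r]) 0 = p" "code_nth (list_encode [p, q, r]) 1 = q"
    "code_nth (list_encode [p, q, r]) 2 = r" for p q r
    by (subst code_nth_list_encode; simp)+
  have "step_ok (sca_encode A) b x y w i \<longleftrightarrow>
      (\<exists>e\<in>set (rule_table A).
         reads b (code_nth e 0) (list_encode (map int_encode (nbh A))) (b + i) x \<and>
         reads b (code_nth e 1) (list_encode (map int_encode (symbol_nbh A))) (b + i) y \<and>
         code_nth e 2 = digit b w i)"
    unfolding step_ok_def code_nth_sca_encode by (rule ex_code_nth_list_encode)
  also have "\<dots> \<longleftrightarrow>
      (\<exists>qs\<in>set (List.n_lists (length (nbh A)) (sorted_list_of_set (states A))).
       \<exists>rs\<in>set (List.n_lists (length (symbol_nbh A)) (sorted_list_of_set (symbols A))).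
         reads b (list_encode qs) (list_encode (map int_encode (nbh A))) (b + i) x \<and>
         reads b (list_encode rs) (list_encode (map int_encode (symbol_nbh A))) (b + i) y \<and>
         rule A qs rs = digit b w i)"
    unfolding rule_table_def by (simp add: entry entry(2)[unfolded One_nat_def] del: list_encode.simps)
  also have "\<dots> \<longleftrightarrow>
      (\<exists>qs\<in>set (List.n_lists (length (nbh A)) (sorted_list_of_set (states A))).
       \<exists>rs\<in>set (List.n_lists (length (symbol_nbh A)) (sorted_list_of_set (symbols A))).
         qs = ?qs \<and> rs = ?rs \<and> rule A qs rs = digit b w i)"
    by (intro bex_cong refl) (simp add: reads_list_encode set_n_lists)
  also have "\<dots> \<longleftrightarrow> rule A ?qs ?rs = digit b w i"
    using mem by blast
  finally show ?thesis unfolding loc .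
qed

lemma count_code_sca_encode:
  assumes A: "stochastic_CA A" and b: "sca_encode A < b"
    and x: "digits b (n + 2 * b) x \<in> words (states A) (n + 2 * b)"
  shows "count_code (sca_encode A) b n x w =
    card {t \<in> words (symbols A) (n + 2 * b). emits A b (digits b (n + 2 * b) x) t (digits b n w)}"
proof -
  note bounds = sca_encode_bounds[OF A b]
  let ?L = "n + 2 * b"
  have "(\<forall>i<?L. code_member (digit b y i) (code_nth (sca_encode A) 1)) \<and> (\<forall>i<n. step_ok (sca_encode A) b x y w i) \<longleftrightarrow>
      digits b ?L y \<in> words (symbols A) ?L \<and> emits A b (digits b ?L x) (digits b ?L y) (digits b n w)" for y
    unfolding code_member_sca_encode(2)[OF A] digits_in_words[symmetric]
    using step_ok_sca_encode[OF A bounds(3) _ x, of _ y w]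
    by (auto simp: emits_def digits_def[of b n])
  then have "count_code (sca_encode A) b n x w =
      card {y. y < b ^ ?L \<and> digits b ?L y \<in> words (symbols A) ?L \<and> emits A b (digits b ?L x) (digits b ?L y) (digits b n w)}"
    unfolding count_code_def by (simp add: sum.If_cases Int_def)
  then show ?thesis
    using card_words_digits[OF _ bounds(2), of ?L] b by simp
qed

lemma symbol_count_code_sca_encode:
  assumes A: "stochastic_CA A" and b: "sca_encode A < b"
  shows "symbol_count_code (sca_encode A) b = card (symbols A)"
proof -
  have "{..<b} \<inter> symbols A = symbols A" using sca_encode_bounds(2)[OF A b] by blast
  then show ?thesis
    unfolding symbol_count_code_def code_member_sca_encode(2)[OF A] by (simp add: sum.If_cases)
qed

lemma equal_code_sca_encode:
  assumes A: "stochastic_CA A" and B: "stochastic_CA B"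
  shows "equal_code (sca_encode A) (sca_encode B) \<longleftrightarrow> stochastic_global A = stochastic_global B"
proof -
  define b where "b = Suc (sca_encode A + sca_encode B)"
  have bA: "sca_encode A < b" and bB: "sca_encode B < b" and b: "0 < b" by (simp_all add: b_def)
  note boundsA = sca_encode_bounds[OF A bA] and boundsB = sca_encode_bounds[OF B bB]
  let ?Q = "states A"
  \<comment> \<open>The bound of \<open>word_prob_eq_of_short\<close> with the numbers of states and
    symbols each estimated by \<open>b\<close>; testing further lengths does no harm.\<close>
  let ?N = "b ^ (2 * b) * (2 * b ^ (2 * b))"
  let ?eq = "\<lambda>u w. word_prob A b u w = word_prob B b u w"
  have fin: "finite (states A)" "finite (states B)" "finite (symbols A)" "finite (symbols B)"
    and pos: "0 < card (symbols A)" "0 < card (symbols B)"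
    using A B by (auto simp: stochastic_CA_def card_gt_0_iff)
  \<comment> \<open>Finite sets are described by their sorted lists, so equality of codes is
    equality of sets.\<close>
  have states: "code_nth (sca_encode A) 0 = code_nth (sca_encode B) 0 \<longleftrightarrow> states A = states B"
    unfolding code_nth_sca_encode list_encode_eq using fin by (metis sorted_list_of_set(1))
  have test: "count_code (sca_encode A) b n x w * symbol_count_code (sca_encode B) b ^ (n + 2 * b) =
      count_code (sca_encode B) b n x w * symbol_count_code (sca_encode A) b ^ (n + 2 * b) \<longleftrightarrow>
      ?eq (digits b (n + 2 * b) x) (digits b n w)"
    if Q: "states A = states B" and x: "digits b (n + 2 * b) x \<in> words ?Q (n + 2 * b)" for n x w
  proof -
    have x': "digits b (n + 2 * b) x \<in> words (states B) (n + 2 * b)" using x Q by simp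
    have len: "length (digits b n w) = n" by (simp add: digits_def)
    let ?c = "\<lambda>D. card {t \<in> words (symbols D) (n + 2 * b). emits D b (digits b (n + 2 * b) x) t (digits b n w)}"
    let ?r = "\<lambda>D. card (symbols D) ^ (n + 2 * b)"
    have "?eq (digits b (n + 2 * b) x) (digits b n w) \<longleftrightarrow> real (?c A) / real (?r A) = real (?c B) / real (?r B)"
      by (simp add: word_prob_def len)
    also have "\<dots> \<longleftrightarrow> real (?c A) * real (?r B) = real (?c B) * real (?r A)"
      using pos by (intro frac_eq_eq) auto
    also have "\<dots> \<longleftrightarrow> ?c A * ?r B = ?c B * ?r A"
      unfolding of_nat_mult[symmetric] of_nat_eq_iff ..
    finally show ?thesis
      unfolding count_code_sca_encode[OF A bA x] count_code_sca_encode[OF B bB x']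
        symbol_count_code_sca_encode[OF A bA] symbol_count_code_sca_encode[OF B bB] by simp
  qed
  have "equal_code (sca_encode A) (sca_encode B) \<longleftrightarrow> states A = states B \<and>
      (\<forall>n<Suc ?N. \<forall>x<b ^ (n + 2 * b). \<forall>w<b ^ n.
        digits b (n + 2 * b) x \<in> words ?Q (n + 2 * b) \<and> digits b n w \<in> words ?Q n \<longrightarrow>
        ?eq (digits b (n + 2 * b) x) (digits b n w))"
    unfolding equal_code_def b_def[symmetric] states code_member_sca_encode(1)[OF A] digits_in_words[symmetric]
    by (intro conj_cong all_cong imp_cong refl test) auto
  also have "\<dots> \<longleftrightarrow> states A = states B \<and>
      (\<forall>n\<le>?N. \<forall>u\<in>words ?Q (n + 2 * b). \<forall>w\<in>words ?Q n. ?eq u w)"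
    unfolding ball_words_digits[OF b boundsA(1)] less_Suc_eq_le by auto
  also have "\<dots> \<longleftrightarrow> states A = states B \<and>
      (\<forall>n. \<forall>u\<in>words ?Q (n + 2 * b). \<forall>w\<in>words ?Q n. ?eq u w)"
  proof -
    have card_le: "card S \<le> b" if "S \<subseteq> {..<b}" for S
      using card_mono[OF _ that] by simp
    have "card ?Q ^ (2 * b) * (card (symbols A) ^ (2 * b) + card (symbols B) ^ (2 * b)) \<le> ?N"
      unfolding mult_2[of "b ^ (2 * b)"]
      by (intro mult_le_mono add_le_mono power_mono card_le boundsA boundsB) auto
    then show ?thesis
      using word_prob_eq_of_short[OF boundsA(3) boundsB(3) fin(1,3,4)] by (meson le_trans)
  qed
  also have "\<dots> \<longleftrightarrow> stochastic_global A = stochastic_global B"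
    using stochastic_global_eq_iff[OF A boundsA(3) B boundsB(3) b] by simp
  finally show ?thesis .
qed

theorem corollary6p2:
  "\<exists>p. \<forall>A B. stochastic_CA A \<longrightarrow> stochastic_CA B \<longrightarrow>
     computes p [sca_encode A, sca_encode B]
       (if stochastic_global A = stochastic_global B then 1 else 0)"
proof -
  obtain p where p: "\<And>e. computes p (map e [0..<2]) (of_bool (equal_code (e 0) (e 1)))"
    using rec_pred_equal_code by (auto simp: recursive_def)
  have run: "computes p [a, a'] (of_bool (equal_code a a'))" for a a'
    using p[of "\<lambda>i. [a, a'] ! i"] by (simp add: upt_rec)
  have verdict: "(if stochastic_global A = stochastic_global B then 1 else 0) =
      (of_bool (equal_code (sca_encode A) (sca_encode B)) :: nat)"
    if "stochastic_CA A" "stochastic_CA B" for A B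
    using that by (simp add: equal_code_sca_encode)
  show ?thesis
    by (intro exI[of _ p] allI impI) (simp only: verdict run)
qed

end
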